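(* Let $e\ge2$, $m\in\mathbb Z/e\mathbb Z$, and $\lambda\in B(\Lambda_m)$ (an $e$-restricted partition), and let $\mathsf m(\lambda)$ be its image under the Mullineux map. Then $\mathrm{ceil}(\mathsf m(\lambda))$ and $\mathrm{floor}(\mathsf m(\lambda))$ are the conjugate partitions of $\mathrm{ceil}(\lambda)$ and $\mathrm{floor}(\lambda)$ respectively.
   Context: Fix $e\ge2$; $\mathfrak g=\mathfrak g(A^{(1)}_{e-1})$ with fundamental weights $\Lambda_i$, $i\in\mathbb Z/e\mathbb Z$. A partition $\lambda=(\lambda_0\ge\lambda_1\ge\cdots)$ is $e$-restricted if $\lambda_k-\lambda_{k+1}<e$ for all $k\ge0$. Crystal. $B(\Lambda_m)$ is realized as the set of $e$-restricted partitions; the node in row $a$, column $b$ (counted from $0$) has residue $m-a+b\bmod e$. Read addable $i$-nodes ($A$) and removable $i$-nodes ($R$) from the first row to the last; repeatedly delete pairs $R\,A$ ($R$ left of $A$, nothing undeleted between) until the form $A\cdots AR\cdots R$; $\tilde f_i\lambda$ adds the node of the rightmost remaining $A$ (or is $0$), $\tilde e_i\lambda$ removes the node of the leftmost remaining $R$ (or is $0$). On $B(\Lambda_m)^{\otimes h}$ use the same rule for the concatenation of the $A/R$ sequences of the tensor factors read from the last factor to the first factor. Ceiling and floor. For $h\ge1$ let $S_h:B(\Lambda_m)\to B(h\Lambda_m)\subset B(\Lambda_m)^{\otimes h}$ be the unique crystal morphism of amplitude $h$: it multiplies $wt,\epsilon_i,\varphi_i$ by $h$ and satisfies $S_h(\tilde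 e_i b)=\tilde e_i^hS_h(b)$, $S_h(\tilde f_ib)=\tilde f_i^hS_h(b)$; in particular $S_h(\emptyset)=\emptyset^{\otimes h}$. Here $B(h\Lambda_m)$ is the component of $\emptyset^{\otimes h}$. It is known that for all sufficiently divisible $h$ all tensor factors of $S_h(\lambda)$ are $e$-cores and $S_h(\lambda)=\nu_1^{\otimes a_1h}\otimes\nu_2^{\otimes(a_2-a_1)h}\otimes\cdots\otimes\nu_s^{\otimes(1-a_{s-1})h}$ with rational numbers $0<a_1<\cdots<a_{s-1}<1$ and pairwise distinct $e$-cores $\nu_1,\dots,\nu_s$ independent of $h$. Then $\mathrm{ceil}(\lambda):=\nu_1$ (first tensor factor) and $\mathrm{floor}(\lambda):=\nu_s$ (last tensor factor). Mullineux map. Let $F$ be an algebraically closed field, $q\in F$ of multiplicative order $e$, and $\mathcal H_n(q)$ the Hecke algebra of type $A$ with generators $T_1,\dots,T_{n-1}$, relations $(T_i-q)(T_i+1)=0$ and the type $A$ braid relations. Its simple modules are $D^\lambda$, $\lambda$ running over $e$-restricted partitions of $n$. Let $\tau$ be the involutive automorphism $T_i\mapsto -qT_i^{-1}$. The Mullineux map is defined by $D^{\mathsf m(\lambda)}=(D^\lambda)^\tau$. It is a known result (used here as a characterization of $\mathsf m$) that if $\lambda=\tilde f_{m+i_1}\cdots\tilde f_{m+i_n}\emptyset$ in $B(\Lambda_m)$, then $\mathsf m(\lambda)=\tilde f_{m-i_1}\cdots\tilde f_{m-i_n}\emptyset$. *)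

theory Defs
  imports
    "HOL-Computational_Algebra.Computational_Algebra"
    "HOL-Number_Theory.Cong"
    "Jordan_Normal_Form.Gauss_Jordan_Elimination"
    "Jordan_Normal_Form.VS_Connect"
begin

section \<open>Partitions\<close>

text \<open>A partition is the infinite weakly decreasing sequence of its parts, eventually zero;
  its nodes are the pairs \<open>(a, b)\<close> (row, column, both counted from zero) with \<open>b < lam a\<close>.\<close>

type_synonym part = "nat \<Rightarrow> nat"

definition partition :: "part \<Rightarrow> bool" where
  "partition lam \<longleftrightarrow> antimono lam \<and> finite {a. lam a \<noteq> 0}"

definition empty_part :: part where
  "empty_part = (\<lambda>_. 0)"

definition psize :: "part \<Rightarrow> nat" where
  "psize lam = (\<Sum>a | lam a \<noteq> 0. lam a)"

definition plength :: "part \<Rightarrow> nat" where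
  "plength lam = card {a. lam a \<noteq> 0}"

definition conj_part :: "part \<Rightarrow> part" where
  "conj_part lam = (\<lambda>b. card {a. b < lam a})"

definition e_restricted :: "nat \<Rightarrow> part \<Rightarrow> bool" where
  "e_restricted e lam \<longleftrightarrow> partition lam \<and> (\<forall>k. lam k - lam (Suc k) < e)"

text \<open>Arm plus leg plus one.\<close>

definition hook_length :: "part \<Rightarrow> nat \<Rightarrow> nat \<Rightarrow> nat" where
  "hook_length lam a b = (lam a - Suc b) + (conj_part lam b - Suc a) + 1"

text \<open>Rim hooks with \<open>e\<close> nodes correspond to nodes of hook length \<open>e\<close>; an \<open>e\<close>-core has none.\<close>

definition e_core :: "nat \<Rightarrow> part \<Rightarrow> bool" where
  "e_core e lam \<longleftrightarrow> partition lam \<and> (\<forall>a b. b < lam a \<longrightarrow> hook_length lam a b \<noteq> e)"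

section \<open>The crystals\<close>

text \<open>Elements of \<open>\<int>/e\<int>\<close> (the charge \<open>m\<close> and the residues \<open>i\<close>) are given by integer
  representatives; everything below depends only on their classes modulo \<open>e\<close>.\<close>

definition has_residue :: "nat \<Rightarrow> int \<Rightarrow> int \<Rightarrow> nat \<Rightarrow> nat \<Rightarrow> bool" where
  "has_residue e m i a b \<longleftrightarrow> [m - int a + int b = i] (mod int e)"

definition addable :: "nat \<Rightarrow> int \<Rightarrow> int \<Rightarrow> part \<Rightarrow> nat \<Rightarrow> bool" where
  "addable e m i lam a \<longleftrightarrow> (a = 0 \<or> lam a < lam (a - 1)) \<and> has_residue e m i a (lam a)"

definition removable :: "nat \<Rightarrow> int \<Rightarrow> int \<Rightarrow> part \<Rightarrow> nat \<Rightarrow> bool" where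
  "removable e m i lam a \<longleftrightarrow> lam (Suc a) < lam a \<and> has_residue e m i a (lam a - 1)"

datatype sgn_AR = SA | SR

text \<open>An entry \<open>(s, k, a)\<close> stands for an addable or removable \<open>i\<close>-node in row \<open>a\<close> of the
  tensor factor number \<open>k\<close>. For \<open>e \<ge> 2\<close> no row contributes both an \<open>SA\<close> and an \<open>SR\<close>.
  Row \<open>plength lam\<close> is the last one which can have an addable node.\<close>

type_synonym entry = "sgn_AR \<times> nat \<times> nat"

definition factor_sequence :: "nat \<Rightarrow> int \<Rightarrow> int \<Rightarrow> nat \<Rightarrow> part \<Rightarrow> entry list" where
  "factor_sequence e m i k lam = concat (map (\<lambda>a.
      (if addable e m i lam a then [(SA, k, a)] else []) @
      (if removable e m i lam a then [(SR, k, a)] else [])) [0..<Suc (plength lam)])"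

text \<open>An element \<open>b\<^sub>1 \<otimes> \<dots> \<otimes> b\<^sub>h\<close> of a tensor power is the list of its factors, and an
  element of \<open>B(\<Lambda>\<^sub>m)\<close> itself is treated as a one-element list. The factors are read from the
  last to the first.\<close>

definition AR_sequence :: "nat \<Rightarrow> int \<Rightarrow> int \<Rightarrow> part list \<Rightarrow> entry list" where
  "AR_sequence e m i bs =
     concat (map (\<lambda>k. factor_sequence e m i k (bs ! k)) (rev [0..<length bs]))"

text \<open>Repeated deletion of pairs \<open>SR, SA\<close>: the first argument is the already reduced initial
  segment, in reversed order.\<close>

fun cancel :: "entry list \<Rightarrow> entry list \<Rightarrow> entry list" where
  "cancel st [] = rev st"
| "cancel ((SR, y) # st) ((SA, x) # xs) = cancel st xs"
| "cancel st (x # xs) = cancel (x # st) xs"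

definition remaining :: "sgn_AR \<Rightarrow> nat \<Rightarrow> int \<Rightarrow> int \<Rightarrow> part list \<Rightarrow> entry list" where
  "remaining s e m i bs = filter (\<lambda>x. fst x = s) (cancel [] (AR_sequence e m i bs))"

text \<open>\<open>None\<close> is the element \<open>0\<close>.\<close>

definition ftilde :: "nat \<Rightarrow> int \<Rightarrow> int \<Rightarrow> part list \<Rightarrow> part list option" where
  "ftilde e m i bs =
     (if remaining SA e m i bs = [] then None
      else let (_, k, a) = last (remaining SA e m i bs)
           in Some (bs[k := (bs ! k)(a := (bs ! k) a + 1)]))"

definition etilde :: "nat \<Rightarrow> int \<Rightarrow> int \<Rightarrow> part list \<Rightarrow> part list option" where
  "etilde e m i bs =
     (if remaining SR e m i bs = [] then None
      else let (_, k, a) = hd (remaining SR e m i bs)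
           in Some (bs[k := (bs ! k)(a := (bs ! k) a - 1)]))"

definition phi :: "nat \<Rightarrow> int \<Rightarrow> int \<Rightarrow> part list \<Rightarrow> nat" where
  "phi e m i bs = length (remaining SA e m i bs)"

definition eps :: "nat \<Rightarrow> int \<Rightarrow> int \<Rightarrow> part list \<Rightarrow> nat" where
  "eps e m i bs = length (remaining SR e m i bs)"

definition ftilde_part :: "nat \<Rightarrow> int \<Rightarrow> int \<Rightarrow> part \<Rightarrow> part option" where
  "ftilde_part e m i lam = map_option hd (ftilde e m i [lam])"

definition etilde_part :: "nat \<Rightarrow> int \<Rightarrow> int \<Rightarrow> part \<Rightarrow> part option" where
  "etilde_part e m i lam = map_option hd (etilde e m i [lam])"

definition iter_option :: "nat \<Rightarrow> ('a \<Rightarrow> 'a option) \<Rightarrow> 'a \<Rightarrow> 'a option" where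
  "iter_option h f x = ((\<lambda>y. Option.bind y f) ^^ h) (Some x)"

text \<open>\<open>f_word e m [j\<^sub>1, \<dots>, j\<^sub>n]\<close> is \<open>f\<^sub>j\<^sub>1 \<dots> f\<^sub>j\<^sub>n \<emptyset>\<close>, so the last letter acts first.\<close>

definition f_word :: "nat \<Rightarrow> int \<Rightarrow> int list \<Rightarrow> part option" where
  "f_word e m js = foldr (\<lambda>j x. Option.bind x (ftilde_part e m j)) js (Some empty_part)"

text \<open>The weight of \<open>b\<^sub>1 \<otimes> \<dots> \<otimes> b\<^sub>h\<close> is \<open>h \<Lambda>\<^sub>m - (\<Sum>i. c\<^sub>i \<alpha>\<^sub>i)\<close>, where \<open>c\<^sub>i\<close> is the number of
  \<open>i\<close>-nodes of all the factors and
  \<open>\<alpha>\<^sub>i = 2 \<Lambda>\<^sub>i - \<Lambda>\<^sub>i\<^sub>-\<^sub>1 - \<Lambda>\<^sub>i\<^sub>+\<^sub>1 + (if i = 0 then \<delta> else 0)\<close>.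
  It is given by its coefficients at the \<open>\<Lambda>\<^sub>i\<close> and at \<open>\<delta>\<close>.\<close>

definition content :: "nat \<Rightarrow> int \<Rightarrow> int \<Rightarrow> part list \<Rightarrow> int" where
  "content e m i bs =
     (\<Sum>lam\<leftarrow>bs. int (card {(a, b). b < lam a \<and> has_residue e m i a b}))"

definition wt_Lambda :: "nat \<Rightarrow> int \<Rightarrow> part list \<Rightarrow> int \<Rightarrow> int" where
  "wt_Lambda e m bs i =
     (if [i = m] (mod int e) then int (length bs) else 0)
       - 2 * content e m i bs + content e m (i + 1) bs + content e m (i - 1) bs"

definition wt_delta :: "nat \<Rightarrow> int \<Rightarrow> part list \<Rightarrow> int" where
  "wt_delta e m bs = - content e m 0 bs"

text \<open>\<open>B(h\<Lambda>\<^sub>m)\<close>, the connected component of \<open>\<emptyset>\<^sup>\<otimes>\<^sup>h\<close>.\<close>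

inductive_set B_component :: "nat \<Rightarrow> int \<Rightarrow> nat \<Rightarrow> part list set"
  for e :: nat and m :: int and h :: nat where
  base: "replicate h empty_part \<in> B_component e m h"
| lower: "bs \<in> B_component e m h \<Longrightarrow> ftilde e m i bs = Some cs \<Longrightarrow> cs \<in> B_component e m h"
| raise: "bs \<in> B_component e m h \<Longrightarrow> etilde e m i bs = Some cs \<Longrightarrow> cs \<in> B_component e m h"

section \<open>Crystal morphisms of amplitude h, ceiling and floor\<close>

text \<open>There is exactly one such map on the \<open>e\<close>-restricted partitions, for every \<open>h \<ge> 1\<close>
  (Kashiwara); its values elsewhere do not matter.\<close>

definition amplitude_morphism :: "nat \<Rightarrow> int \<Rightarrow> nat \<Rightarrow> (part \<Rightarrow> part list) \<Rightarrow> bool" where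
  "amplitude_morphism e m h S \<longleftrightarrow>
     S empty_part = replicate h empty_part \<and>
     (\<forall>lam. e_restricted e lam \<longrightarrow>
        S lam \<in> B_component e m h \<and>
        (\<forall>i. wt_Lambda e m (S lam) i = int h * wt_Lambda e m [lam] i) \<and>
        wt_delta e m (S lam) = int h * wt_delta e m [lam] \<and>
        (\<forall>i. eps e m i (S lam) = h * eps e m i [lam] \<and>
             phi e m i (S lam) = h * phi e m i [lam] \<and>
             map_option S (etilde_part e m i lam) = iter_option h (etilde e m i) (S lam) \<and>
             map_option S (ftilde_part e m i lam) = iter_option h (ftilde e m i) (S lam)))"

text \<open>Here \<open>as\<close> is the list of the inner breakpoints \<open>a\<^sub>1 < \<dots> < a\<^sub>s\<^sub>-\<^sub>1\<close>, and \<open>c ! j\<close> the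
  exponent of the \<open>j\<close>-th core; the exponents are required to be natural numbers for all
  sufficiently divisible \<open>h\<close>.\<close>

definition core_factorization ::
  "nat \<Rightarrow> (nat \<Rightarrow> part \<Rightarrow> part list) \<Rightarrow> part \<Rightarrow> rat list \<Rightarrow> part list \<Rightarrow> bool" where
  "core_factorization e S lam as nus \<longleftrightarrow>
     length nus = length as + 1 \<and>
     sorted_wrt (<) (0 # as @ [1]) \<and>
     distinct nus \<and> (\<forall>nu \<in> set nus. e_core e nu) \<and>
     (\<exists>N>0. \<forall>h>0. N dvd h \<longrightarrow>
        (\<exists>c. length c = length nus \<and>
             (\<forall>j < length nus.
                of_nat (c ! j) = ((0 # as @ [1]) ! Suc j - (0 # as @ [1]) ! j) * of_nat h) \<and>
             S h lam = concat (map2 replicate c nus)))"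

definition ceil_part :: "nat \<Rightarrow> (nat \<Rightarrow> part \<Rightarrow> part list) \<Rightarrow> part \<Rightarrow> part" where
  "ceil_part e S lam = (THE nu. \<exists>as nus. core_factorization e S lam as nus \<and> nu = hd nus)"

definition floor_part :: "nat \<Rightarrow> (nat \<Rightarrow> part \<Rightarrow> part list) \<Rightarrow> part \<Rightarrow> part" where
  "floor_part e S lam = (THE nu. \<exists>as nus. core_factorization e S lam as nus \<and> nu = last nus)"

section \<open>Hecke algebras and the Mullineux map\<close>

definition has_mult_order :: "'F::field \<Rightarrow> nat \<Rightarrow> bool" where
  "has_mult_order q e \<longleftrightarrow> e > 0 \<and> q ^ e = 1 \<and> (\<forall>k. 0 < k \<and> k < e \<longrightarrow> q ^ k \<noteq> 1)"

text \<open>A finite-dimensional module over the Hecke algebra with parameter \<open>q\<close> and generators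
  \<open>T\<^sub>1, \<dots>, T\<^sub>n\<^sub>-\<^sub>1\<close> is given by its dimension and the matrices of the generators.\<close>

type_synonym 'F hecke_mod = "nat \<times> (nat \<Rightarrow> 'F mat)"

definition hecke_module :: "'F::field \<Rightarrow> nat \<Rightarrow> 'F hecke_mod \<Rightarrow> bool" where
  "hecke_module q n V \<longleftrightarrow> (case V of (d, T) \<Rightarrow>
     (\<forall>k \<in> {1..<n}. T k \<in> carrier_mat d d \<and>
        (T k - q \<cdot>\<^sub>m 1\<^sub>m d) * (T k + 1\<^sub>m d) = 0\<^sub>m d d) \<and>
     (\<forall>k \<in> {1..<n}. Suc k < n \<longrightarrow> T k * T (Suc k) * T k = T (Suc k) * T k * T (Suc k)) \<and>
     (\<forall>k \<in> {1..<n}. \<forall>l \<in> {1..<n}. Suc k < l \<longrightarrow> T k * T l = T l * T k))"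

definition hecke_simple :: "'F::field \<Rightarrow> nat \<Rightarrow> 'F hecke_mod \<Rightarrow> bool" where
  "hecke_simple q n V \<longleftrightarrow> hecke_module q n V \<and> (case V of (d, T) \<Rightarrow>
     d > 0 \<and>
     (\<forall>W. VectorSpace.subspace class_ring W (module_vec TYPE('F) d) \<and>
          (\<forall>k \<in> {1..<n}. \<forall>w \<in> W. T k *\<^sub>v w \<in> W)
          \<longrightarrow> W = {0\<^sub>v d} \<or> W = carrier_vec d))"

definition hecke_iso :: "nat \<Rightarrow> 'F::field hecke_mod \<Rightarrow> 'F hecke_mod \<Rightarrow> bool" where
  "hecke_iso n V V' \<longleftrightarrow> (case V of (d, T) \<Rightarrow> case V' of (d', T') \<Rightarrow>
     d = d' \<and>
     (\<exists>P \<in> carrier_mat d d. invertible_mat P \<and> (\<forall>k \<in> {1..<n}. P * T k = T' k * P)))"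

text \<open>The twist by \<open>T\<^sub>i \<mapsto> -q T\<^sub>i\<^sup>-\<^sup>1\<close>.\<close>

definition hecke_twist :: "'F::field \<Rightarrow> 'F hecke_mod \<Rightarrow> 'F hecke_mod" where
  "hecke_twist q V = (case V of (d, T) \<Rightarrow> (d, \<lambda>k. (- q) \<cdot>\<^sub>m the (mat_inverse (T k))))"

text \<open>\<open>D\<close> lists the simple modules, up to isomorphism and without repetition, by the
  \<open>e\<close>-restricted partitions.\<close>

definition simple_labelling :: "nat \<Rightarrow> 'F::field \<Rightarrow> (part \<Rightarrow> 'F hecke_mod) \<Rightarrow> bool" where
  "simple_labelling e q D \<longleftrightarrow>
     (\<forall>lam. e_restricted e lam \<longrightarrow> hecke_simple q (psize lam) (D lam)) \<and>
     (\<forall>n V. hecke_simple q n V \<longrightarrow>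
        (\<exists>!lam. e_restricted e lam \<and> psize lam = n \<and> hecke_iso n V (D lam)))"

definition mullineux :: "nat \<Rightarrow> 'F::field \<Rightarrow> (part \<Rightarrow> 'F hecke_mod) \<Rightarrow> part \<Rightarrow> part" where
  "mullineux e q D lam =
     (THE mu. e_restricted e mu \<and> psize mu = psize lam \<and>
        hecke_iso (psize lam) (D mu) (hecke_twist q (D lam)))"

text \<open>The description of the Mullineux map by the crystal \<open>B(\<Lambda>\<^sub>m)\<close>. It is a theorem for the
  usual modules \<open>D\<close>, but it would fail for an arbitrary relabelling of them, so it is
  also what fixes the labelling.\<close>

definition mullineux_by_crystal ::
  "nat \<Rightarrow> int \<Rightarrow> 'F::field \<Rightarrow> (part \<Rightarrow> 'F hecke_mod) \<Rightarrow> bool" where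
  "mullineux_by_crystal e m q D \<longleftrightarrow>
     (\<forall>js lam. f_word e m (map (\<lambda>j. m + j) js) = Some lam \<longrightarrow>
               f_word e m (map (\<lambda>j. m - j) js) = Some (mullineux e q D lam))"

end

theory Submission
  imports Defs
begin

text \<open>A core has no addable and removable nodes of the same residue. So for sufficiently divisible
  \<open>h\<close> the operator \<open>f\<^sub>i\<^sup>h\<close>, applied to a tensor product of cores in which each factor is repeated
  often enough, adds to each factor either all its addable \<open>i\<close>-nodes or none, and which of the two
  happens depends only on the numbers of addable and removable \<open>i\<close>-nodes of the factors. These
  numbers, and the operation of adding all addable \<open>i\<close>-nodes to a core, are compatible with
  conjugation when \<open>i = m + j\<close> is replaced by \<open>m - j\<close>. By induction along a word leading from the
  empty partition to \<open>\<lambda>\<close>, the factors of \<open>S\<^sub>h\<close> at the Mullineux image of \<open>\<lambda>\<close> are the conjugates of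
  those at \<open>\<lambda>\<close>. The same induction shows that the factors form a weakly decreasing chain for
  inclusion, so that equal ones are adjacent and the decomposition defining ceiling and floor
  exists.\<close>

section \<open>Cancellation in words of addable and removable nodes\<close>

text \<open>Conjugation reverses the order in which the nodes of one partition are read, so it does
  not commute with a single application of a crystal operator, and the Mullineux image is in general
  not the conjugate. It does commute once every factor receives all of its addable nodes or none,
  because then only the order of the factors counts. The obstacle is that the nodes added by
  \<open>f_i^h\<close> may begin in the middle of a factor. Repeating each factor \<open>M\<close>
  times, with \<open>M\<close> a multiple of all the nonzero numbers of addable nodes, moves this
  beginning to a boundary between copies. The amplitudes are treated together: one finite list of
  cores describes \<open>S h\<close> for all positive multiples \<open>h\<close> of its length, and
  each letter of the word replaces the list by one that is \<open>M\<close> times longer.\<close>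

fun unmatched_A :: "nat \<Rightarrow> entry list \<Rightarrow> entry list" where
  "unmatched_A r [] = []"
| "unmatched_A r ((SR, y) # w) = unmatched_A (Suc r) w"
| "unmatched_A 0 ((SA, y) # w) = (SA, y) # unmatched_A 0 w"
| "unmatched_A (Suc r) ((SA, y) # w) = unmatched_A r w"

text \<open>The state after reading a word: the \<open>SR\<close>s still waiting for a partner.
  Truncated subtraction is intended, since an \<open>SA\<close> that meets no open \<open>SR\<close>
  survives and leaves the state at 0. Together with \<open>unmatched_A\<close> this is a
  left-to-right automaton that replaces the stack of \<open>cancel\<close> by a number.\<close>

fun open_R :: "nat \<Rightarrow> entry list \<Rightarrow> nat" where
  "open_R r [] = r"
| "open_R r ((SR, y) # w) = open_R (Suc r) w"
| "open_R r ((SA, y) # w) = open_R (r - 1) w"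

lemma unmatched_A_append:
  "unmatched_A r (u @ v) = unmatched_A r u @ unmatched_A (open_R r u) v"
  by (induction r u rule: unmatched_A.induct) auto

lemma open_R_append: "open_R r (u @ v) = open_R (open_R r u) v"
  by (induction r u rule: open_R.induct) auto

text \<open>An additional open \<open>SR\<close> is passed along until it meets the first
  \<open>SA\<close> that would have survived and cancels it; from there on the state is the same as
  without it.\<close>

lemma unmatched_A_Suc: "unmatched_A (Suc r) w = tl (unmatched_A r w)"
  by (induction r w rule: unmatched_A.induct) auto

text \<open>Skipping the first \<open>r\<close> survivors is thus the same as starting with
  \<open>r\<close> open \<open>SR\<close>s. This encoding is what makes iterated operators
  computable factor by factor.\<close>

lemma unmatched_A_eq_drop: "unmatched_A r w = drop r (unmatched_A 0 w)"
  by (induction r) (auto simp: unmatched_A_Suc tl_drop drop_Suc)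

lemma set_unmatched_A: "set (unmatched_A r w) \<subseteq> set w \<inter> {x. fst x = SA}"
  by (induction r w rule: unmatched_A.induct) auto

lemma distinct_unmatched_A: "distinct w \<Longrightarrow> distinct (unmatched_A r w)"
  using set_unmatched_A by (induction r w rule: unmatched_A.induct) force+

lemma open_R_Suc: "unmatched_A r w \<noteq> [] \<Longrightarrow> open_R (Suc r) w = open_R r w"
  by (induction r w rule: unmatched_A.induct) auto

text \<open>The reduced segment always has the form \<open>A...AR...R\<close>, stored in reverse as
  \<open>Rs @ As\<close>, and only the length of \<open>Rs\<close> influences the rest.\<close>

lemma filter_cancel:
  assumes "\<forall>x \<in> set Rs. fst x = SR" "\<forall>x \<in> set As. fst x = SA"
  shows "filter (\<lambda>x. fst x = SA) (cancel (Rs @ As) w) = rev As @ unmatched_A (length Rs) w"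
  using assms
proof (induction w arbitrary: Rs As)
  case Nil
  then show ?case by (auto simp: filter_empty_conv filter_id_conv)
next
  case (Cons x w)
  obtain s y where x: "x = (s, y)" by (cases x)
  show ?case
  proof (cases s)
    case SR
    then show ?thesis using Cons.IH[of "x # Rs" As] Cons.prems by (simp add: x)
  next
    case SA
    show ?thesis
    proof (cases Rs)
      case Nil
      have "cancel As (x # w) = cancel (x # As) w"
        using Cons.prems by (cases As) (auto simp: x SA)
      then show ?thesis using Cons.IH[of "[]" "x # As"] Cons.prems by (simp add: x SA Nil)
    next
      case (Cons z Rs')
      then obtain y' where "z = (SR, y')" using Cons.prems by (cases z) auto
      then show ?thesis using Cons.IH[of Rs' As] Cons.prems Cons by (simp add: x SA)
    qed
  qed
qed

lemma remaining_SA: "remaining SA e m i bs = unmatched_A 0 (AR_sequence e m i bs)"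
  using filter_cancel[of "[]" "[]"] by (simp add: remaining_def)

text \<open>The position \<open>z\<close> is a pair of factor and row; adding a node there turns its
  \<open>SA\<close> into an \<open>SR\<close>.\<close>

definition flip :: "nat \<times> nat \<Rightarrow> entry \<Rightarrow> entry" where
  "flip z x = (if snd x = z then (SR, z) else x)"

lemma map_flip_id: "z \<notin> snd ` set w \<Longrightarrow> map (flip z) w = w"
  by (force simp: flip_def intro!: map_idI)

text \<open>Nothing survives to the right of the last surviving \<open>SA\<close>, and an extra
  \<open>SR\<close> cannot create survivors, so the flip costs exactly this one. Distinct positions
  ensure that no other entry changes.\<close>

lemma unmatched_A_flip_last:
  assumes "distinct (map snd w)" "unmatched_A r w \<noteq> []"
  shows "unmatched_A r (map (flip (snd (last (unmatched_A r w)))) w) = butlast (unmatched_A r w)"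
  using assms
proof (induction r w rule: unmatched_A.induct)
  case (2 r y w)
  then have "last (unmatched_A (Suc r) w) \<in> set w"
    using set_unmatched_A[of "Suc r" w] last_in_set[of "unmatched_A (Suc r) w"] by fastforce
  with 2 show ?case by (auto simp: flip_def)
next
  case (3 y w)
  show ?case
  proof (cases "unmatched_A 0 w = []")
    case True
    then show ?thesis using 3 unmatched_A_Suc[of 0 w] by (simp add: map_flip_id) (simp add: flip_def)
  next
    case False
    then have "last (unmatched_A 0 w) \<in> set w"
      using set_unmatched_A[of 0 w] last_in_set by blast
    with 3 False show ?thesis by (auto simp: flip_def)
  qed
next
  case (4 r y w)
  then have "last (unmatched_A r w) \<in> set w"
    using set_unmatched_A[of r w] last_in_set[of "unmatched_A r w"] by fastforce
  with 4 show ?case by (cases "unmatched_A r w = []") (auto simp: flip_def)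
qed auto

text \<open>An \<open>SR\<close> stays uncancelled exactly when the word behind it, read from state
  0, has no surviving \<open>SA\<close>. An open \<open>SR\<close> at the end must come from such an
  entry.\<close>

lemma ex_unmatched_R:
  assumes "open_R 0 w > 0"
  obtains u y v where "w = u @ (SR, y) # v" "unmatched_A 0 v = []"
proof -
  have "\<exists>u y v. w = u @ (SR, y) # v \<and> unmatched_A 0 v = []"
    using assms
  proof (induction w)
    case (Cons x w)
    obtain s y where x: "x = (s, y)" by (cases x)
    show ?case
    proof (cases "s = SR \<and> unmatched_A 0 w = []")
      case True
      then show ?thesis by (metis append_Nil x)
    next
      case False
      then have "open_R 0 w > 0"
        using Cons.prems open_R_Suc[of 0 w] by (cases s) (auto simp: x)
      then obtain u z v where "w = u @ (SR, z) # v" "unmatched_A 0 v = []"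
        using Cons.IH by blast
      then show ?thesis by (metis append_Cons)
    qed
  qed simp
  then show ?thesis using that by blast
qed

section \<open>Adding a node to a partition\<close>

lemma partition_iff:
  "partition lam \<longleftrightarrow> (\<forall>a. lam (Suc a) \<le> lam a) \<and> (\<exists>n. \<forall>a\<ge>n. lam a = 0)"
proof -
  have "finite {a. lam a \<noteq> 0} \<longleftrightarrow> (\<exists>n. \<forall>a\<ge>n. lam a = 0)"
    by (metis (mono_tags, lifting) finite_nat_set_iff_bounded mem_Collect_eq not_le)
  then show ?thesis
    unfolding partition_def
    by (metis antimono_iff_le_Suc)
qed

lemma partition_antimono: "partition lam \<Longrightarrow> a \<le> b \<Longrightarrow> lam b \<le> lam a"
  by (simp add: partition_def antimonoD)

lemma nodes_eq_lessThan:
  assumes "partition lam"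
  shows "{a. b < lam a} = {..<conj_part lam b}"
proof -
  obtain n where n: "\<And>a. b < lam a \<Longrightarrow> a < n"
    using assms unfolding partition_iff by (metis not_le not_less_zero)
  have down: "b < lam a \<Longrightarrow> a' \<le> a \<Longrightarrow> b < lam a'" for a a'
    using partition_antimono[OF assms, of a' a] by linarith
  define k where "k = (LEAST k. \<not> b < lam k)"
  have "\<not> b < lam n" using n by blast
  then have "\<not> b < lam k" unfolding k_def by (rule LeastI)
  moreover have "b < lam a" if "a < k" for a using that not_less_Least unfolding k_def by blast
  ultimately have "{a. b < lam a} = {..<k}" using down by (auto simp: not_le[symmetric])
  then show ?thesis by (simp add: conj_part_def)
qed

lemma less_conj_part: "partition lam \<Longrightarrow> a < conj_part lam b \<longleftrightarrow> b < lam a"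
  using nodes_eq_lessThan[of lam b] by blast

lemma row_eq_0_iff: "partition lam \<Longrightarrow> lam a = 0 \<longleftrightarrow> plength lam \<le> a"
  using less_conj_part[of lam a 0] by (auto simp: conj_part_def plength_def)

lemma part_eqI:
  fixes lam mu :: part
  assumes "\<And>a b. b < lam a \<longleftrightarrow> b < mu a"
  shows "lam = mu"
  using assms by (metis ext linorder_less_linear less_irrefl)

lemma partition_conj_part:
  assumes "partition lam"
  shows "partition (conj_part lam)"
proof -
  have "conj_part lam (Suc b) \<le> conj_part lam b" for b
    using less_conj_part[OF assms, of _ b] less_conj_part[OF assms, of _ "Suc b"]
    by (metis Suc_lessD not_le less_irrefl)
  moreover have "conj_part lam b = 0" if "b \<ge> lam 0" for b
    using less_conj_part[OF assms, of 0 b] that by simp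
  ultimately show ?thesis unfolding partition_iff by blast
qed

lemma conj_conj_part: "partition lam \<Longrightarrow> conj_part (conj_part lam) = lam"
  by (rule part_eqI) (simp add: less_conj_part partition_conj_part)

lemma conj_part_inject:
  "partition lam \<Longrightarrow> partition mu \<Longrightarrow> conj_part lam = conj_part mu \<longleftrightarrow> lam = mu"
  by (metis conj_conj_part)

lemma conj_empty_part: "conj_part empty_part = empty_part"
  by (auto simp: conj_part_def empty_part_def)

lemma partition_empty_part: "partition empty_part"
  by (simp add: partition_iff empty_part_def)

section \<open>Residues and reading sequences of one partition\<close>

lemma has_residue_alt: "has_residue e m i a b \<longleftrightarrow> [int b - int a = i - m] (mod int e)"
  by (simp add: has_residue_def cong_iff_dvd_diff algebra_simps)

text \<open>Places on neighbouring diagonals have different residues. This is what keeps a new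
  \<open>i\<close>-node from interfering with the other \<open>i\<close>-nodes next to it.\<close>

lemma cong_off_by_one:
  assumes "e \<ge> 2" "[x = c] (mod int e)" "[y = c] (mod int e)" "x = y + 1"
  shows False
proof -
  have "int e dvd (x - c) - (y - c)"
    using assms(2,3) by (simp only: cong_iff_dvd_diff dvd_diff)
  then show False using assms(1,4) by (simp add: zdvd_not_zless)
qed

lemma addable_not_removable:
  assumes "e \<ge> 2" "addable e m i lam a"
  shows "\<not> removable e m i lam a"
proof
  assume rem: "removable e m i lam a"
  then have "int (lam a) - int a = (int (lam a - 1) - int a) + 1"
    by (simp add: removable_def of_nat_diff)
  with cong_off_by_one[OF assms(1)] assms(2) rem show False
    unfolding addable_def removable_def has_residue_alt by blast
qed

definition row_sequence :: "nat \<Rightarrow> int \<Rightarrow> int \<Rightarrow> nat \<Rightarrow> part \<Rightarrow> nat \<Rightarrow> entry list" where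
  "row_sequence e m i k lam a =
     (if addable e m i lam a then [(SA, k, a)] else []) @
     (if removable e m i lam a then [(SR, k, a)] else [])"

lemma row_sequence_beyond:
  "partition lam \<Longrightarrow> plength lam < a \<Longrightarrow> row_sequence e m i k lam a = []"
  using row_eq_0_iff[of lam a] row_eq_0_iff[of lam "a - 1"]
  by (auto simp: row_sequence_def addable_def removable_def)

lemma row_le_plength:
  assumes "partition lam" "addable e m i lam a \<or> removable e m i lam a"
  shows "a \<le> plength lam"
  using row_sequence_beyond[OF assms(1), of a e m i 0] assms(2)
  by (auto simp: row_sequence_def not_less[symmetric] split: if_splits)

text \<open>Later rows contribute nothing, so the cut-off may be moved. This allows a common range
  of rows for two partitions of different length.\<close>

lemma factor_sequence_upto:
  assumes "partition lam" "plength lam < n"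
  shows "factor_sequence e m i k lam = concat (map (row_sequence e m i k lam) [0..<n])"
proof -
  obtain d where "n = Suc (plength lam) + d" using assms(2) by (metis Suc_leI le_Suc_ex)
  then have "[0..<n] = [0..<Suc (plength lam)] @ [Suc (plength lam)..<n]"
    using upt_add_eq_append[of 0 "Suc (plength lam)" d] by simp
  then have "concat (map (row_sequence e m i k lam) [0..<n]) =
      concat (map (row_sequence e m i k lam) [0..<Suc (plength lam)])"
    using row_sequence_beyond[OF assms(1)] by (simp del: upt_Suc)
  then show ?thesis by (simp add: factor_sequence_def row_sequence_def[abs_def] del: upt_Suc)
qed

lemma set_factor_sequence:
  assumes "partition lam"
  shows "(s, k', a) \<in> set (factor_sequence e m i k lam) \<longleftrightarrow>
    k' = k \<and> (case s of SA \<Rightarrow> addable e m i lam a | SR \<Rightarrow> removable e m i lam a)"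
  using row_le_plength[OF assms, of e m i a]
  by (cases s) (auto simp: factor_sequence_def less_Suc_eq_le split: if_splits simp del: upt_Suc)

lemma sorted_concat_rows:
  assumes "e \<ge> 2"
  shows "sorted_wrt (<) (map (\<lambda>x. snd (snd x)) (concat (map (row_sequence e m i k lam) [0..<n])))"
  using addable_not_removable[OF assms, of m i lam]
  by (induction n) (auto simp: sorted_wrt_append row_sequence_def split: if_splits)

lemma sorted_factor_sequence:
  assumes "e \<ge> 2"
  shows "sorted_wrt (<) (map (\<lambda>x. snd (snd x)) (factor_sequence e m i k lam))"
  using sorted_concat_rows[OF assms, of m i k lam "Suc (plength lam)"]
  by (simp add: factor_sequence_def row_sequence_def[abs_def] del: upt_Suc)

lemma distinct_factor_sequence:
  assumes "e \<ge> 2"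
  shows "distinct (map snd (factor_sequence e m i k lam))"
proof -
  have "distinct (map snd (map snd (factor_sequence e m i k lam)))"
    using sorted_factor_sequence[OF assms, of m i k lam]
    by (metis (no_types, lifting) list.map_comp comp_def map_eq_conv strict_sorted_iff)
  then show ?thesis by (simp only: distinct_map)
qed

section \<open>Effect of one new node on the addable and removable nodes\<close>

definition add_box :: "part \<Rightarrow> nat \<Rightarrow> part" where
  "add_box lam a = lam(a := lam a + 1)"

lemma partition_add_box:
  assumes "partition lam" "addable e m i lam a"
  shows "partition (add_box lam a)"
proof -
  obtain n where "\<And>a. a \<ge> n \<Longrightarrow> lam a = 0" using assms(1) unfolding partition_iff by blast
  then have "\<forall>b\<ge>max n (Suc a). add_box lam a b = 0" by (simp add: add_box_def)
  moreover have "add_box lam a (Suc b) \<le> add_box lam a b" for b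
    using assms(2) partition_antimono[OF assms(1), of b "Suc b"]
    by (auto simp: add_box_def addable_def)
  ultimately show ?thesis unfolding partition_iff by blast
qed

text \<open>Besides row \<open>a\<close>, only row \<open>Suc a\<close> can change, by gaining an
  addable place. That place lies directly below the new node and has residue \<open>i - 1\<close>;
  the next place in row \<open>a\<close> has residue \<open>i + 1\<close>.\<close>

lemma addable_add_box:
  assumes "e \<ge> 2" "partition lam" "addable e m i lam a"
  shows "addable e m i (add_box lam a) b \<longleftrightarrow> addable e m i lam b \<and> b \<noteq> a"
proof -
  have res: "[int (lam a) - int a = i - m] (mod int e)"
    using assms(3) by (simp add: addable_def has_residue_alt)
  show ?thesis
  proof (cases "b = a \<or> b = Suc a")
    case True
    then show ?thesis
    proof
      assume "b = a"
      then show ?thesis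
        using cong_off_by_one[OF assms(1) _ res, of "int (Suc (lam a)) - int a"]
        by (auto simp: addable_def add_box_def has_residue_alt)
    next
      assume b: "b = Suc a"
      have "lam (Suc a) < lam a" if "lam (Suc a) \<le> lam a"
        "[int (lam (Suc a)) - int (Suc a) = i - m] (mod int e)"
        using cong_off_by_one[OF assms(1) res that(2)] that(1) by force
      then show ?thesis
        using partition_antimono[OF assms(2), of a "Suc a"]
        by (auto simp: b addable_def add_box_def has_residue_alt)
    qed
  next
    case False
    then show ?thesis by (auto simp: addable_def add_box_def)
  qed
qed

text \<open>The node directly above the new one may cease to be removable, but its residue is
  \<open>i + 1\<close>.\<close>

lemma removable_add_box:
  assumes "e \<ge> 2" "partition lam" "addable e m i lam a"
  shows "removable e m i (add_box lam a) b \<longleftrightarrow> removable e m i lam b \<or> b = a"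
proof -
  have res: "[int (lam a) - int a = i - m] (mod int e)"
    using assms(3) by (simp add: addable_def has_residue_alt)
  consider "b = a" | "a = Suc b" | "b \<noteq> a" "a \<noteq> Suc b" by blast
  then show ?thesis
  proof cases
    case 1
    then show ?thesis
      using partition_antimono[OF assms(2), of a "Suc a"] res
      by (auto simp: removable_def add_box_def has_residue_alt)
  next
    case 2
    have "lam b \<noteq> Suc (lam a)" if "[int (lam b - 1) - int b = i - m] (mod int e)"
      using cong_off_by_one[OF assms(1) that res] 2 by auto
    then show ?thesis
      using assms(3) 2 by (auto simp: removable_def addable_def add_box_def has_residue_alt)
  next
    case 3
    then show ?thesis by (auto simp: removable_def add_box_def)
  qed
qed

lemma factor_sequence_add_box:
  assumes "e \<ge> 2" "partition lam" "addable e m i lam a"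
  shows "factor_sequence e m i k (add_box lam a) = map (flip (k, a)) (factor_sequence e m i k lam)"
proof -
  define n where "n = Suc (max (plength lam) (plength (add_box lam a)))"
  have "row_sequence e m i k (add_box lam a) =
      (\<lambda>b. map (flip (k, a)) (row_sequence e m i k lam b))"
    using addable_not_removable[OF assms(1,3)] assms(3)
    by (auto simp: fun_eq_iff row_sequence_def addable_add_box[OF assms] removable_add_box[OF assms] flip_def)
  then show ?thesis
    using factor_sequence_upto[OF assms(2), of n]
      factor_sequence_upto[OF partition_add_box[OF assms(2,3)], of n]
    by (simp add: n_def map_concat comp_def del: upt_Suc)
qed

section \<open>Generation of the crystal from the empty partition\<close>

lemma ftilde_alt:
  "ftilde e m i bs =
     (let u = unmatched_A 0 (AR_sequence e m i bs) in
      if u = [] then None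
      else let (_, k, a) = last u in Some (bs[k := add_box (bs ! k) a]))"
  by (simp add: ftilde_def remaining_SA add_box_def Let_def)

lemma AR_sequence_single: "AR_sequence e m i [lam] = factor_sequence e m i 0 lam"
  by (simp add: AR_sequence_def)

text \<open>An \<open>SA\<close> survives when no \<open>SR\<close> is open on its arrival, and it
  is the last survivor when the rest, read from state 0, leaves none. The choice made by
  \<open>ftilde\<close> thus becomes a condition on a splitting of the word.\<close>

lemma last_unmatched_A:
  assumes "unmatched_A r w \<noteq> []"
  obtains u y v where "w = u @ (SA, y) # v" "open_R r u = 0" "unmatched_A 0 v = []"
    "last (unmatched_A r w) = (SA, y)"
proof -
  have "\<exists>u y v. w = u @ (SA, y) # v \<and> open_R r u = 0 \<and> unmatched_A 0 v = [] \<and>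
    last (unmatched_A r w) = (SA, y)"
    using assms
  proof (induction r w rule: unmatched_A.induct)
    case (2 r y w)
    then show ?case by (fastforce intro: exI[of _ "(SR, y) # _"])
  next
    case (3 y w)
    show ?case
    proof (cases "unmatched_A 0 w = []")
      case True
      then show ?thesis by (intro exI[of _ "[]"]) auto
    next
      case False
      with 3 show ?thesis by (fastforce intro: exI[of _ "(SA, y) # _"])
    qed
  next
    case (4 r y w)
    then show ?case by (fastforce intro: exI[of _ "(SA, y) # _"])
  qed simp
  then show ?thesis using that by blast
qed

lemma ftilde_part_SomeD:
  assumes "ftilde_part e m i lam = Some mu"
  obtains u k a v where "factor_sequence e m i 0 lam = u @ (SA, k, a) # v" "open_R 0 u = 0"
    "unmatched_A 0 v = []" "mu = add_box lam a"
proof -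
  let ?w = "factor_sequence e m i 0 lam"
  have ne: "unmatched_A 0 ?w \<noteq> []"
    using assms by (auto simp: ftilde_part_def ftilde_alt AR_sequence_single Let_def)
  then obtain u y v where *: "?w = u @ (SA, y) # v" "open_R 0 u = 0" "unmatched_A 0 v = []"
    "last (unmatched_A 0 ?w) = (SA, y)"
    by (rule last_unmatched_A)
  obtain k a where y: "y = (k, a)" by (cases y)
  have "(SA, k, a) \<in> set ?w" by (simp add: * y)
  then have "k = 0" by (auto simp: factor_sequence_def split: if_splits)
  then show ?thesis
    using that[of u k a v] * assms ne
    by (auto simp: y ftilde_part_def ftilde_alt AR_sequence_single Let_def)
qed

lemma ftilde_part_SomeI:
  assumes "factor_sequence e m i 0 lam = u @ (SA, 0, a) # v" "open_R 0 u = 0" "unmatched_A 0 v = []"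
  shows "ftilde_part e m i lam = Some (add_box lam a)"
  using assms by (simp add: ftilde_part_def ftilde_alt AR_sequence_single Let_def unmatched_A_append)

lemma sorted_factor_sequenceD:
  assumes "e \<ge> 2" "factor_sequence e m i k lam = u @ (s, y) # v"
  shows "\<forall>x \<in> set u. snd (snd x) < snd y" "\<forall>x \<in> set v. snd y < snd (snd x)"
    "sorted_wrt (<) (map (\<lambda>x. snd (snd x)) v)"
  using sorted_factor_sequence[OF assms(1), of m i k lam] by (auto simp: assms(2) sorted_wrt_append)

text \<open>If the new node in row \<open>a\<close> broke the condition, rows \<open>a\<close> and
  \<open>Suc a\<close> would differ by \<open>e - 1\<close>. The place at the end of row
  \<open>Suc a\<close> would then be addable of the same residue and would come next in the
  sequence, hence survive, although the operator chose the rightmost survivor.\<close>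

lemma e_restricted_ftilde_part:
  assumes "e \<ge> 2" "e_restricted e lam" "ftilde_part e m i lam = Some mu"
  shows "e_restricted e mu"
proof -
  have part: "partition lam" and restr: "\<And>k. lam k - lam (Suc k) < e"
    using assms(2) by (auto simp: e_restricted_def)
  obtain u k a v where w: "factor_sequence e m i 0 lam = u @ (SA, k, a) # v" "open_R 0 u = 0"
    "unmatched_A 0 v = []" and mu: "mu = add_box lam a"
    using assms(3) by (rule ftilde_part_SomeD)
  have "(SA, k, a) \<in> set (factor_sequence e m i 0 lam)" by (simp add: w)
  then have add: "addable e m i lam a" and k: "k = 0"
    by (simp_all add: set_factor_sequence[OF part])
  have "mu b - mu (Suc b) < e" for b
  proof (rule ccontr)
    assume neg: "\<not> ?thesis"
    then have b: "b = a" using restr[of b] unfolding mu add_box_def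
      by (cases "b = a"; cases "Suc b = a") auto
    with neg restr[of a] have eq: "lam a = lam (Suc a) + (e - 1)"
      using assms(1) by (auto simp: mu add_box_def)
    have "[int (lam a) - int a - int e = i - m] (mod int e)"
      using add by (simp add: addable_def has_residue_alt cong_def)
    moreover have "int (lam (Suc a)) - int (Suc a) = (int (lam a) - int a) - int e"
      using eq assms(1) by simp
    ultimately have "[int (lam (Suc a)) - int (Suc a) = i - m] (mod int e)"
      by (simp only:)
    then have "addable e m i lam (Suc a)"
      using eq assms(1) by (simp add: addable_def has_residue_alt)
    then have "(SA, 0, Suc a) \<in> set (factor_sequence e m i 0 lam)"
      by (simp add: set_factor_sequence[OF part])
    then have mem: "(SA, 0, Suc a) \<in> set v"
      using sorted_factor_sequenceD[OF assms(1) w(1)] by (force simp: w)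
    then obtain z v' where v: "v = z # v'" by (cases v) auto
    have "z = (SA, 0, Suc a)"
      using mem sorted_factor_sequenceD(2,3)[OF assms(1) w(1)] by (force simp: v)
    then show False using w(3) by (simp add: v)
  qed
  then show ?thesis
    using partition_add_box[OF part add] by (simp add: e_restricted_def mu)
qed

lemma psize_upto:
  assumes "\<And>a. a \<ge> n \<Longrightarrow> lam a = 0"
  shows "psize lam = (\<Sum>a<n. lam a)"
  unfolding psize_def
proof (rule sum.mono_neutral_left)
  show "{a. lam a \<noteq> 0} \<subseteq> {..<n}" using assms by (metis (mono_tags) lessThan_iff mem_Collect_eq not_le subsetI)
qed auto

lemma psize_add_box:
  assumes "partition lam"
  shows "psize (add_box lam a) = Suc (psize lam)"
proof -
  obtain n where n: "\<And>a. a \<ge> n \<Longrightarrow> lam a = 0" using assms unfolding partition_iff by blast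
  define N where "N = max n (Suc a)"
  have "psize (add_box lam a) = (\<Sum>b<N. add_box lam a b)"
    by (rule psize_upto) (auto simp: add_box_def N_def n)
  also have "\<dots> = (\<Sum>b<N. lam b + (if b = a then 1 else 0))"
    by (rule sum.cong) (auto simp: add_box_def)
  also have "\<dots> = (\<Sum>b<N. lam b) + 1"
    by (simp add: sum.distrib N_def)
  also have "(\<Sum>b<N. lam b) = psize lam"
    by (rule psize_upto[symmetric]) (auto simp: N_def n)
  finally show ?thesis by simp
qed

text \<open>Take for \<open>i\<close> the residue of the end of the last nonempty row
  \<open>c\<close>. Only row \<open>Suc c\<close> could supply an \<open>SA\<close> behind this
  \<open>SR\<close>, and equal residues would force \<open>e\<close> to divide \<open>lam c\<close>,
  which lies strictly between 0 and \<open>e\<close>. So an uncancelled \<open>SR\<close>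
  exists.\<close>

lemma ex_ftilde_part:
  assumes e: "e \<ge> 2" and restr: "e_restricted e lam" and ne: "lam \<noteq> empty_part"
  obtains i mu where "e_restricted e mu" "ftilde_part e m i mu = Some lam" "psize mu < psize lam"
proof -
  have part: "partition lam" and re: "\<And>k. lam k - lam (Suc k) < e"
    using restr by (auto simp: e_restricted_def)
  obtain b where "lam b \<noteq> 0" using ne by (auto simp: empty_part_def)
  then obtain c where c: "plength lam = Suc c"
    using row_eq_0_iff[OF part, of b] by (cases "plength lam") auto
  have c1: "lam c \<noteq> 0" "lam (Suc c) = 0"
    using row_eq_0_iff[OF part, of c] row_eq_0_iff[OF part, of "Suc c"] by (auto simp: c)
  then have c2: "lam c < e" using re[of c] by simp
  define i where "i = m - int c + int (lam c - 1)"
  let ?w = "factor_sequence e m i 0 lam"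
  define good where
    "good a \<longleftrightarrow> (\<exists>u v. ?w = u @ (SR, 0, a) # v \<and> unmatched_A 0 v = [])" for a
  have "removable e m i lam c" using c1 by (simp add: removable_def has_residue_def i_def)
  then have "(SR, 0, c) \<in> set ?w" by (simp add: set_factor_sequence[OF part])
  then obtain u v where uv: "?w = u @ (SR, 0, c) # v" by (meson split_list)
  have "x \<notin> set v" if SA: "fst x = SA" for x
  proof
    assume x: "x \<in> set v"
    obtain k d where xd: "x = (SA, k, d)" using SA by (metis prod.collapse)
    have "c < d" using sorted_factor_sequenceD(2)[OF e uv] x by (auto simp: xd)
    moreover have "(SA, k, d) \<in> set ?w" using x uv by (simp add: xd)
    then have add: "addable e m i lam d" by (simp add: set_factor_sequence[OF part])
    ultimately have "lam d < lam (d - 1)" by (auto simp: addable_def)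
    then have "d - 1 < Suc c" using row_eq_0_iff[OF part, of "d - 1"] by (auto simp: c)
    with \<open>c < d\<close> have d: "d = Suc c" by simp
    have "[- int (Suc c) = int (lam c) - 1 - int c] (mod int e)"
      using add c1 by (simp add: addable_def has_residue_alt d i_def of_nat_diff algebra_simps)
    then have "int e dvd int (lam c)" by (simp add: cong_iff_dvd_diff)
    then show False using c1 c2 by (simp add: nat_dvd_not_less)
  qed
  then have "unmatched_A 0 v = []" using set_unmatched_A[of 0 v] by (cases "unmatched_A 0 v") auto
  then have "good c" using uv by (auto simp: good_def)
  \<comment> \<open>The leftmost uncancelled \<open>SR\<close>, as in the rule for
    \<open>e_i\<close>. Its minimality leaves no open \<open>SR\<close> before it and also keeps the
    smaller partition restricted.\<close>
  define a where "a = (LEAST a. good a)"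
  have "good a" unfolding a_def using \<open>good c\<close> by (rule LeastI)
  then obtain u v where uv: "?w = u @ (SR, 0, a) # v" and v: "unmatched_A 0 v = []"
    by (auto simp: good_def)
  have not_good: "\<not> good b" if "b < a" for b using that not_less_Least unfolding a_def by blast
  have unm: "unmatched_A r v = []" for r using v unmatched_A_eq_drop[of r v] by simp
  have "open_R 0 u = 0"
  proof (rule ccontr)
    assume "open_R 0 u \<noteq> 0"
    then obtain u1 y u2 where u: "u = u1 @ (SR, y) # u2" "unmatched_A 0 u2 = []"
      using ex_unmatched_R by blast
    have "(SR, y) \<in> set ?w" by (simp add: uv u)
    then obtain b where y: "y = (0, b)" by (cases y) (simp add: set_factor_sequence[OF part])
    have "good b" unfolding good_def using uv u
      by (intro exI[of _ u1] exI[of _ "u2 @ (SR, 0, a) # v"]) (simp add: y unmatched_A_append unm)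
    moreover have "b < a" using sorted_factor_sequenceD(1)[OF e uv] by (simp add: u y)
    ultimately show False using not_good by blast
  qed
  have "(SR, 0, a) \<in> set ?w" by (simp add: uv)
  then have rem: "removable e m i lam a" by (simp add: set_factor_sequence[OF part])
  define mu where "mu = lam(a := lam a - 1)"
  have lam: "lam = add_box mu a" using rem by (auto simp: mu_def add_box_def removable_def fun_eq_iff)
  obtain n where "\<And>a. a \<ge> n \<Longrightarrow> lam a = 0" using part unfolding partition_iff by blast
  then have "\<forall>a\<ge>n. mu a = 0" by (simp add: mu_def)
  moreover have "mu (Suc b) \<le> mu b" for b
    using partition_antimono[OF part, of b "Suc b"] rem by (auto simp: mu_def removable_def)
  ultimately have part_mu: "partition mu" unfolding partition_iff by blast
  have "a = 0 \<or> lam a - 1 < lam (a - 1)"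
    using rem partition_antimono[OF part, of "a - 1" a] by (auto simp: removable_def)
  then have add: "addable e m i mu a" using rem by (auto simp: addable_def removable_def mu_def)
  have "mu b - mu (Suc b) < e" for b
  proof (rule ccontr)
    assume neg: "\<not> ?thesis"
    then have a: "a = Suc b" using re[of b] unfolding mu_def
      by (cases "b = a"; cases "Suc b = a") auto
    \<comment> \<open>The ends of rows \<open>b\<close> and \<open>Suc b\<close> now differ in
      content by \<open>e\<close>, so row \<open>b\<close> carries an \<open>SR\<close> of the same
      residue immediately before that of row \<open>a\<close>; it is uncancelled too, against
      minimality.\<close>
    with neg re[of b] rem have eq: "lam b = lam a + (e - 1)"
      using e by (auto simp: mu_def removable_def)
    have "[int (lam a - 1) - int a = i - m] (mod int e)"
      using rem unfolding removable_def has_residue_alt by blast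
    moreover have "int (lam b - 1) - int b = (int (lam a - 1) - int a) + int e"
      using eq e rem by (simp add: a removable_def of_nat_diff)
    ultimately have "[int (lam b - 1) - int b = i - m] (mod int e)"
      by (simp add: cong_def)
    then have "removable e m i lam b"
      using eq e rem by (simp add: removable_def has_residue_alt a)
    then have "(SR, 0, b) \<in> set ?w"
      by (simp add: set_factor_sequence[OF part])
    then have "(SR, 0, b) \<in> set u"
      using sorted_factor_sequenceD(2)[OF e uv] by (auto simp: uv a)
    then obtain u1 u2 where u: "u = u1 @ (SR, 0, b) # u2" by (meson split_list)
    have uv': "?w = u1 @ (SR, 0, b) # (u2 @ (SR, 0, a) # v)" using uv u by simp
    have "u2 = []"
    proof (cases u2)
      case (Cons z zs)
      then have "b < snd (snd z)" "snd (snd z) < a"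
        using sorted_factor_sequenceD(2)[OF e uv'] sorted_factor_sequenceD(1)[OF e uv] u by auto
      then show ?thesis by (simp add: a)
    qed
    then have "good b" unfolding good_def using uv'
      by (intro exI[of _ u1] exI[of _ "(SR, 0, a) # v"]) (simp add: unm)
    then show False using not_good a by blast
  qed
  then have "e_restricted e mu" using part_mu by (simp add: e_restricted_def)
  moreover have "ftilde_part e m i mu = Some lam"
  proof -
    let ?w' = "factor_sequence e m i 0 mu"
    have "(SA, 0, a) \<in> set ?w'" using add by (simp add: set_factor_sequence[OF part_mu])
    then obtain u' v' where w': "?w' = u' @ (SA, 0, a) # v'" by (meson split_list)
    have "distinct (map snd ?w')" by (rule distinct_factor_sequence[OF e])
    then have nin: "(0, a) \<notin> snd ` set u'" "(0, a) \<notin> snd ` set v'" by (auto simp: w')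
    have "?w = u' @ (SR, 0, a) # v'"
      unfolding lam factor_sequence_add_box[OF e part_mu add]
      using nin by (simp add: w' map_flip_id) (simp add: flip_def)
    moreover have "(SR, 0, a) \<notin> set u'" "(SR, 0, a) \<notin> set v'" using nin by force+
    ultimately have "u' = u" "v' = v" using uv append_Cons_eq_iff by metis+
    then show ?thesis
      using ftilde_part_SomeI[OF w'] \<open>open_R 0 u = 0\<close> v lam by simp
  qed
  moreover have "psize mu < psize lam" using psize_add_box[OF part_mu, of a] by (simp add: lam[symmetric])
  ultimately show ?thesis using that by blast
qed

lemma ex_f_word:
  assumes "e \<ge> 2" "e_restricted e lam"
  obtains js where "f_word e m js = Some lam"
proof -
  have "\<exists>js. f_word e m js = Some lam"
    using assms(2)
  proof (induction "psize lam" arbitrary: lam rule: less_induct)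
    case less
    show ?case
    proof (cases "lam = empty_part")
      case True
      then show ?thesis by (intro exI[of _ "[]"]) (simp add: f_word_def)
    next
      case False
      obtain i mu where "e_restricted e mu" "ftilde_part e m i mu = Some lam" "psize mu < psize lam"
        using ex_ftilde_part[OF assms(1) less.prems False] by metis
      moreover then obtain js where "f_word e m js = Some mu" using less.hyps by blast
      ultimately show ?thesis by (intro exI[of _ "i # js"]) (simp add: f_word_def)
    qed
  qed
  then show ?thesis using that by blast
qed

section \<open>Iterated crystal operators on tensor products\<close>

text \<open>Adds simultaneously the nodes that \<open>E\<close> marks with \<open>SA\<close>; a row
  receives at most one node of a given residue.\<close>

definition fill :: "entry set \<Rightarrow> part list \<Rightarrow> part list" where
  "fill E bs = map (\<lambda>k a. (bs ! k) a + (if (SA, k, a) \<in> E then 1 else 0)) [0..<length bs]"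

text \<open>The last factor is read first, so inductions over tensor products peel factors off at
  the end.\<close>

lemma AR_sequence_snoc:
  "AR_sequence e m i (bs @ [b]) = factor_sequence e m i (length bs) b @ AR_sequence e m i bs"
  unfolding AR_sequence_def by (auto simp: nth_append intro!: arg_cong[where f = concat] map_cong)

lemma set_AR_sequence:
  assumes "\<forall>b \<in> set bs. partition b"
  shows "(s, k, a) \<in> set (AR_sequence e m i bs) \<longleftrightarrow> k < length bs \<and>
    (case s of SA \<Rightarrow> addable e m i (bs ! k) a | SR \<Rightarrow> removable e m i (bs ! k) a)"
  using assms by (auto simp: AR_sequence_def set_factor_sequence)

lemma distinct_AR_sequence:
  assumes "e \<ge> 2" "\<forall>b \<in> set bs. partition b"
  shows "distinct (map snd (AR_sequence e m i bs))"
  using assms(2)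
proof (induction bs rule: rev_induct)
  case Nil
  then show ?case by (simp add: AR_sequence_def)
next
  case (snoc b bs)
  have "fst y < length bs" if "y \<in> snd ` set (AR_sequence e m i bs)" for y
    using that set_AR_sequence[of bs] snoc.prems by fastforce
  moreover have "fst y = length bs" if "y \<in> snd ` set (factor_sequence e m i (length bs) b)" for y
    using that set_factor_sequence[of b] snoc.prems by fastforce
  ultimately have "snd ` set (factor_sequence e m i (length bs) b) \<inter> snd ` set (AR_sequence e m i bs) = {}"
    by (metis disjoint_iff less_irrefl)
  then show ?case
    using snoc.IH snoc.prems distinct_factor_sequence[OF assms(1), of m i "length bs" b]
    by (simp add: AR_sequence_snoc)
qed

lemma AR_sequence_add_box:
  assumes "e \<ge> 2" "\<forall>b \<in> set bs. partition b" "k < length bs" "addable e m i (bs ! k) a"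
  shows "AR_sequence e m i (bs[k := add_box (bs ! k) a]) = map (flip (k, a)) (AR_sequence e m i bs)"
  using assms(2-)
proof (induction bs rule: rev_induct)
  case (snoc b bs)
  show ?case
  proof (cases "k = length bs")
    case True
    have "(k, a) \<notin> snd ` set (AR_sequence e m i bs)"
      using set_AR_sequence[of bs] snoc.prems(1) True by fastforce
    then show ?thesis
      using snoc.prems factor_sequence_add_box[OF assms(1), of b m i a k]
      by (simp add: True AR_sequence_snoc map_flip_id)
  next
    case False
    have "(k, a) \<notin> snd ` set (factor_sequence e m i (length bs) b)"
      using set_factor_sequence[of b] snoc.prems(1) False by fastforce
    moreover have k: "k < length bs" using snoc.prems(2) False by simp
    ultimately show ?thesis
      using snoc by (simp add: AR_sequence_snoc list_update_append nth_append map_flip_id)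
  qed
qed simp

lemma iter_option_0: "iter_option 0 f x = Some x"
  by (simp add: iter_option_def)

lemma iter_option_Suc: "f x = Some y \<Longrightarrow> iter_option (Suc n) f x = iter_option n f y"
  by (simp add: iter_option_def funpow_swap1[symmetric] funpow_Suc_right del: funpow.simps)

text \<open>Each application uses up the last survivor and no other, so \<open>n\<close>
  applications fill the last \<open>n\<close> survivors. The others are skipped by starting with
  that many open \<open>SR\<close>s.\<close>

lemma iter_ftilde:
  assumes "e \<ge> 2" "\<forall>b \<in> set bs. partition b" "n \<le> length (unmatched_A 0 (AR_sequence e m i bs))"
  shows "iter_option n (ftilde e m i) bs =
    Some (fill (set (unmatched_A (length (unmatched_A 0 (AR_sequence e m i bs)) - n)
      (AR_sequence e m i bs))) bs)"
  using assms(2-)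
proof (induction n arbitrary: bs)
  case 0
  have "fill {} bs = bs" by (auto simp: fill_def intro!: nth_equalityI)
  then show ?case by (simp add: iter_option_0 unmatched_A_eq_drop[of "length _"])
next
  case (Suc n)
  let ?w = "AR_sequence e m i bs"
  let ?u = "unmatched_A 0 ?w"
  have ne: "?u \<noteq> []" using Suc.prems by auto
  have last_mem: "last ?u \<in> set ?w" "fst (last ?u) = SA"
    using set_unmatched_A[of 0 ?w] last_in_set[OF ne] by auto
  then obtain k a where last: "last ?u = (SA, k, a)" by (metis prod.collapse)
  have ka: "k < length bs" "addable e m i (bs ! k) a"
    using last_mem set_AR_sequence[OF Suc.prems(1), of SA k a e m i] by (auto simp: last)
  define cs where "cs = bs[k := add_box (bs ! k) a]"
  have f: "ftilde e m i bs = Some cs"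
    using ne by (simp add: ftilde_alt Let_def last cs_def)
  have dist: "distinct (map snd ?w)" by (rule distinct_AR_sequence[OF assms(1) Suc.prems(1)])
  have AR: "AR_sequence e m i cs = map (flip (k, a)) ?w"
    unfolding cs_def by (rule AR_sequence_add_box[OF assms(1) Suc.prems(1) ka])
  have u': "unmatched_A 0 (AR_sequence e m i cs) = butlast ?u"
    using unmatched_A_flip_last[OF dist ne] by (simp add: AR last)
  have "\<forall>b \<in> set cs. partition b"
    using Suc.prems(1) partition_add_box[OF _ ka(2)] ka(1)
    by (auto simp: cs_def dest!: set_update_subset_insert[THEN subsetD])
  then have "iter_option n (ftilde e m i) cs =
      Some (fill (set (drop (length ?u - 1 - n) (butlast ?u))) cs)"
    using Suc.IH[of cs] Suc.prems(2) by (simp add: u' unmatched_A_eq_drop[of "_ - _"])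
  moreover have "fill (set (drop (length ?u - 1 - n) (butlast ?u))) cs =
      fill (set (drop (length ?u - Suc n) ?u)) bs"
  proof -
    let ?E = "set (drop (length ?u - Suc n) (butlast ?u))"
    have dr: "drop (length ?u - Suc n) ?u = drop (length ?u - Suc n) (butlast ?u) @ [(SA, k, a)]"
    proof -
      have "?u = butlast ?u @ [(SA, k, a)]" using ne last by (metis append_butlast_last_id)
      then have "drop (length ?u - Suc n) ?u = drop (length ?u - Suc n) (butlast ?u @ [(SA, k, a)])"
        by metis
      then show ?thesis by simp
    qed
    have "distinct ?u" using distinct_unmatched_A dist by (simp add: distinct_map)
    then have "(SA, k, a) \<notin> set (butlast ?u)"
      using ne last by (metis append_butlast_last_id distinct_append disjoint_iff list.set_intros(1))
    \<comment> \<open>The node already added in \<open>cs\<close> must not be counted a second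
      time.\<close>
    then have nin: "(SA, k, a) \<notin> ?E" using in_set_dropD by fast
    then show ?thesis
      using ka(1) by (auto simp: dr fill_def cs_def nth_list_update add_box_def intro!: map_cong ext)
  qed
  ultimately show ?case
    by (simp add: iter_option_Suc[of "ftilde e m i" bs cs, OF f] unmatched_A_eq_drop[of "_ - _"])
qed

section \<open>Tensor products of factors without internal cancellation\<close>

definition addable_rows :: "nat \<Rightarrow> int \<Rightarrow> int \<Rightarrow> part \<Rightarrow> nat list" where
  "addable_rows e m i lam = filter (addable e m i lam) [0..<Suc (plength lam)]"

definition removable_rows :: "nat \<Rightarrow> int \<Rightarrow> int \<Rightarrow> part \<Rightarrow> nat list" where
  "removable_rows e m i lam = filter (removable e m i lam) [0..<Suc (plength lam)]"

text \<open>No cancellation takes place inside a factor of this kind; all cores are such.\<close>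

definition pure :: "nat \<Rightarrow> int \<Rightarrow> int \<Rightarrow> part \<Rightarrow> bool" where
  "pure e m i lam \<longleftrightarrow> partition lam \<and> \<not> ((\<exists>a. addable e m i lam a) \<and> (\<exists>a. removable e m i lam a))"

abbreviation num_add :: "nat \<Rightarrow> int \<Rightarrow> int \<Rightarrow> part \<Rightarrow> nat" where
  "num_add e m i lam \<equiv> length (addable_rows e m i lam)"

abbreviation num_rem :: "nat \<Rightarrow> int \<Rightarrow> int \<Rightarrow> part \<Rightarrow> nat" where
  "num_rem e m i lam \<equiv> length (removable_rows e m i lam)"

lemma set_addable_rows: "partition lam \<Longrightarrow> set (addable_rows e m i lam) = {a. addable e m i lam a}"
  using row_le_plength[of lam e m i]
  by (auto simp: addable_rows_def less_Suc_eq_le simp del: upt_Suc)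

lemma set_removable_rows: "partition lam \<Longrightarrow> set (removable_rows e m i lam) = {a. removable e m i lam a}"
  using row_le_plength[of lam e m i]
  by (auto simp: removable_rows_def less_Suc_eq_le simp del: upt_Suc)

lemma num_add_card: "partition lam \<Longrightarrow> num_add e m i lam = card {a. addable e m i lam a}"
  by (metis set_addable_rows distinct_card addable_rows_def distinct_filter distinct_upt)

lemma num_rem_card: "partition lam \<Longrightarrow> num_rem e m i lam = card {a. removable e m i lam a}"
  by (metis set_removable_rows distinct_card removable_rows_def distinct_filter distinct_upt)

lemma concat_map_if: "concat (map (\<lambda>x. if P x then [f x] else []) xs) = map f (filter P xs)"
  by (induction xs) auto

text \<open>One of the two lists is empty, so writing the \<open>SA\<close>s before the
  \<open>SR\<close>s does not disturb the order of rows.\<close>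

lemma factor_sequence_pure:
  assumes "pure e m i lam"
  shows "factor_sequence e m i k lam = map (\<lambda>a. (SA, k, a)) (addable_rows e m i lam) @
    map (\<lambda>a. (SR, k, a)) (removable_rows e m i lam)"
proof (cases "\<exists>a. addable e m i lam a")
  case True
  then have "\<not> removable e m i lam a" for a using assms by (auto simp: pure_def)
  then show ?thesis
    by (simp add: factor_sequence_def addable_rows_def removable_rows_def concat_map_if del: upt_Suc)
next
  case False
  then show ?thesis
    by (simp add: factor_sequence_def addable_rows_def removable_rows_def concat_map_if del: upt_Suc)
qed

lemma unmatched_A_As: "unmatched_A r (map (\<lambda>a. (SA, k, a)) xs) = map (\<lambda>a. (SA, k, a)) (drop r xs)"
proof (induction xs arbitrary: r)
  case (Cons x xs)
  then show ?case by (cases r) (auto simp: Cons.IH[of 0, simplified])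
qed simp

lemma open_R_As: "open_R r (map (\<lambda>a. (SA, k, a)) xs) = r - length xs"
  by (induction xs arbitrary: r) auto

lemma unmatched_A_Rs: "unmatched_A r (map (\<lambda>a. (SR, k, a)) xs) = []"
  by (induction xs arbitrary: r) auto

lemma open_R_Rs: "open_R r (map (\<lambda>a. (SR, k, a)) xs) = r + length xs"
  by (induction xs arbitrary: r) auto

lemmas pure_factor_simps =
  factor_sequence_pure unmatched_A_append open_R_append unmatched_A_As unmatched_A_Rs open_R_As open_R_Rs

text \<open>The factors are consumed here in reading order, that is, from the last one to the first.
  Counting \<open>r\<close> initial unmatched removable nodes amounts to leaving out the first \<open>r\<close>
  remaining addable ones.\<close>

fun fill_reading :: "nat \<Rightarrow> int \<Rightarrow> int \<Rightarrow> nat \<Rightarrow> part list \<Rightarrow> part list" where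
  "fill_reading e m i r [] = []"
| "fill_reading e m i r (x # xs) =
     (\<lambda>a. x a + (if a \<in> set (drop r (addable_rows e m i x)) then 1 else 0)) #
     fill_reading e m i (r - num_add e m i x + num_rem e m i x) xs"

fun num_unmatched :: "nat \<Rightarrow> int \<Rightarrow> int \<Rightarrow> nat \<Rightarrow> part list \<Rightarrow> nat" where
  "num_unmatched e m i r [] = 0"
| "num_unmatched e m i r (x # xs) =
     num_add e m i x - r + num_unmatched e m i (r - num_add e m i x + num_rem e m i x) xs"

lemma length_unmatched_A:
  assumes "\<forall>b \<in> set bs. pure e m i b"
  shows "length (unmatched_A r (AR_sequence e m i bs)) = num_unmatched e m i r (rev bs)"
  using assms
proof (induction bs arbitrary: r rule: rev_induct)
  case Nil
  then show ?case by (simp add: AR_sequence_def)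
next
  case (snoc b bs)
  then show ?case by (simp add: AR_sequence_snoc pure_factor_simps)
qed

lemma fill_unmatched_A:
  assumes "\<forall>b \<in> set bs. pure e m i b"
  shows "fill (set (unmatched_A r (AR_sequence e m i bs))) bs = rev (fill_reading e m i r (rev bs))"
  using assms
proof (induction bs arbitrary: r rule: rev_induct)
  case Nil
  then show ?case by (simp add: fill_def)
next
  case (snoc b bs)
  define r' where "r' = r - num_add e m i b + num_rem e m i b"
  let ?D = "drop r (addable_rows e m i b)"
  let ?U = "unmatched_A r' (AR_sequence e m i bs)"
  have u: "unmatched_A r (AR_sequence e m i (bs @ [b])) = map (\<lambda>a. (SA, length bs, a)) ?D @ ?U"
    using snoc.prems by (simp add: AR_sequence_snoc pure_factor_simps r'_def)
  have "\<forall>b \<in> set bs. partition b" using snoc.prems by (simp add: pure_def)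
  then have "k < length bs" if "(SA, k, a) \<in> set ?U" for k a
    using that set_unmatched_A[of r' "AR_sequence e m i bs"] set_AR_sequence[of bs SA k a e m i] by blast
  then have "fill (set (map (\<lambda>a. (SA, length bs, a)) ?D @ ?U)) (bs @ [b]) =
      fill (set ?U) bs @ [\<lambda>a. b a + (if a \<in> set ?D then 1 else 0)]"
    unfolding fill_def by (auto simp: nth_append fun_eq_iff image_iff intro!: map_cong)
  also have "fill (set ?U) bs = rev (fill_reading e m i r' (rev bs))"
    using snoc by simp
  finally show ?case by (simp add: u r'_def)
qed

lemma iter_ftilde_pure:
  assumes "e \<ge> 2" "\<forall>b \<in> set bs. pure e m i b" "n \<le> num_unmatched e m i 0 (rev bs)"
  shows "iter_option n (ftilde e m i) bs =
    Some (rev (fill_reading e m i (num_unmatched e m i 0 (rev bs) - n) (rev bs)))"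
proof -
  have "\<forall>b \<in> set bs. partition b" using assms(2) by (simp add: pure_def)
  from iter_ftilde[OF assms(1) this, of n m i] show ?thesis
    using assms(3) by (simp add: length_unmatched_A[OF assms(2)] fill_unmatched_A[OF assms(2)])
qed

section \<open>Cores, beta numbers and conjugation\<close>

text \<open>The bead positions of the partition on the abacus, for charge 0: the content of the
  first place to the right of row \<open>a\<close>. Adding a node moves a bead one step to the
  right.\<close>

definition beta :: "part \<Rightarrow> nat \<Rightarrow> int" where
  "beta lam a = int (lam a) - int a"

lemma beta_less:
  assumes "partition lam" "a < b"
  shows "beta lam b < beta lam a"
  using partition_antimono[OF assms(1), of a b] assms(2) by (simp add: beta_def)

lemma beta_plus_one:
  assumes "partition lam"
  shows "beta lam a + 1 \<in> range (beta lam) \<longleftrightarrow> a \<noteq> 0 \<and> lam (a - 1) = lam a"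
proof
  assume "beta lam a + 1 \<in> range (beta lam)"
  then obtain b where b: "beta lam b = beta lam a + 1" by auto
  then have "b < a" using beta_less[OF assms, of a b] by (cases a b rule: linorder_cases) auto
  moreover have "a \<le> Suc b"
  proof (rule ccontr)
    assume "\<not> ?thesis"
    then show False
      using beta_less[OF assms, of b "Suc b"] beta_less[OF assms, of "Suc b" a] b by simp
  qed
  ultimately have "a = Suc b" by simp
  then show "a \<noteq> 0 \<and> lam (a - 1) = lam a" using b by (simp add: beta_def)
next
  assume *: "a \<noteq> 0 \<and> lam (a - 1) = lam a"
  then have "beta lam (a - 1) = beta lam a + 1" by (simp add: beta_def of_nat_diff)
  then show "beta lam a + 1 \<in> range (beta lam)" by (metis rangeI)
qed

lemma addable_beta:
  assumes "partition lam"
  shows "addable e m i lam a \<longleftrightarrow>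
    [beta lam a = i - m] (mod int e) \<and> beta lam a + 1 \<notin> range (beta lam)"
  using partition_antimono[OF assms, of "a - 1" a]
  by (auto simp: addable_def has_residue_alt beta_plus_one[OF assms] beta_def[symmetric])

lemma removable_beta:
  assumes "partition lam"
  shows "removable e m i lam a \<longleftrightarrow>
    [beta lam a - 1 = i - m] (mod int e) \<and> beta lam a - 1 \<notin> range (beta lam)"
proof -
  have "beta lam a - 1 \<in> range (beta lam) \<longleftrightarrow> lam (Suc a) = lam a"
  proof
    assume "beta lam a - 1 \<in> range (beta lam)"
    then obtain b where b: "beta lam a - 1 = beta lam b" by auto
    then have "beta lam b + 1 \<in> range (beta lam)" by (metis diff_add_cancel rangeI)
    then have *: "b \<noteq> 0" "lam (b - 1) = lam b" using beta_plus_one[OF assms] by auto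
    then have "beta lam (b - 1) = beta lam a" using b by (simp add: beta_def of_nat_diff)
    then have "b - 1 = a" using beta_less[OF assms] by (metis less_irrefl linorder_less_linear)
    then show "lam (Suc a) = lam a" using * by auto
  next
    assume "lam (Suc a) = lam a"
    then have "beta lam a - 1 = beta lam (Suc a)" by (simp add: beta_def)
    then show "beta lam a - 1 \<in> range (beta lam)" by simp
  qed
  moreover have "int (lam a - 1) - int a = beta lam a - 1" if "lam (Suc a) < lam a"
    using that by (simp add: beta_def of_nat_diff)
  moreover have "lam (Suc a) < lam a \<longleftrightarrow> lam (Suc a) \<noteq> lam a"
    using partition_antimono[OF assms, of a "Suc a"] by auto
  ultimately show ?thesis
    unfolding removable_def has_residue_alt by metis
qed

text \<open>Along the boundary of the diagram every integer is either a vertical step, which is the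
  bead of a row, or a horizontal step, which is the gap of a column.\<close>

lemma not_beta_iff:
  assumes "partition lam"
  shows "z \<notin> range (beta lam) \<longleftrightarrow> (\<exists>b. z = int b + 1 - int (conj_part lam b))"
proof
  assume z: "z \<notin> range (beta lam)"
  \<comment> \<open>The number of beads to the right of \<open>z\<close>; it turns out to be the
    length of the column \<open>b\<close> whose gap is \<open>z\<close>.\<close>
  define a where "a = (LEAST a. beta lam a < z)"
  obtain n where n: "\<And>a. a \<ge> n \<Longrightarrow> lam a = 0" using assms unfolding partition_iff by blast
  \<comment> \<open>Far enough down the rows are empty and the beads are \<open>- a\<close>, so some
    bead lies to the left of \<open>z\<close>.\<close>
  have "beta lam (max n (nat (1 - z))) < z" using n by (simp add: beta_def)
  then have a: "beta lam a < z" unfolding a_def by (rule LeastI)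
  have a': "z < beta lam (a - 1)" if "a \<noteq> 0"
    using not_less_Least[of "a - 1" "\<lambda>a. beta lam a < z"] that z
    by (metis a_def diff_less less_one linorder_less_linear not_gr_zero rangeI)
  define b where "b = nat (z - 1 + int a)"
  have b: "int b = z - 1 + int a" using a by (simp add: b_def beta_def)
  have "\<not> a < conj_part lam b" using a b by (simp add: less_conj_part[OF assms] beta_def)
  moreover have "\<not> conj_part lam b < a"
  proof
    assume "conj_part lam b < a"
    then have "\<not> a - 1 < conj_part lam b" "a \<noteq> 0" by auto
    moreover have "a - 1 < conj_part lam b"
      using a' b \<open>a \<noteq> 0\<close> by (simp add: less_conj_part[OF assms] beta_def of_nat_diff)
    ultimately show False by simp
  qed
  ultimately have "conj_part lam b = a" by simp
  then show "\<exists>b. z = int b + 1 - int (conj_part lam b)" using b by (intro exI[of _ b]) simp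
next
  assume "\<exists>b. z = int b + 1 - int (conj_part lam b)"
  then obtain b where z: "z = int b + 1 - int (conj_part lam b)" by blast
  show "z \<notin> range (beta lam)"
  proof
    assume "z \<in> range (beta lam)"
    then obtain a where "int (lam a) - int a = int b + 1 - int (conj_part lam b)"
      by (auto simp: z beta_def)
    then show False using less_conj_part[OF assms, of a b] by linarith
  qed
qed

lemma hook_length_beta:
  assumes "partition lam" "b < lam a"
  shows "int (hook_length lam a b) = beta lam a - (int b + 1 - int (conj_part lam b))"
  using less_conj_part[OF assms(1), of a b] assms(2)
  by (simp add: hook_length_def beta_def of_nat_diff)

text \<open>A hook length is the distance from a bead to a gap on its left. So a core is an abacus
  whose beads are pushed down without gaps on each of the \<open>e\<close> runners.\<close>

lemma e_core_iff_beta: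
  assumes "e > 0"
  shows "e_core e lam \<longleftrightarrow>
    partition lam \<and> (\<forall>x. x \<in> range (beta lam) \<longrightarrow> x - int e \<in> range (beta lam))"
proof (cases "partition lam")
  case part: True
  have "(\<forall>a b. b < lam a \<longrightarrow> hook_length lam a b \<noteq> e) \<longleftrightarrow>
    (\<forall>a. beta lam a - int e \<in> range (beta lam))"
  proof (intro iffI allI impI)
    fix a assume core: "\<forall>a b. b < lam a \<longrightarrow> hook_length lam a b \<noteq> e"
    show "beta lam a - int e \<in> range (beta lam)"
    proof (rule ccontr)
      assume "beta lam a - int e \<notin> range (beta lam)"
      then obtain b where b: "beta lam a - int e = int b + 1 - int (conj_part lam b)"
        using not_beta_iff[OF part] by blast
      then have "b < lam a" using assms less_conj_part[OF part, of a b] unfolding beta_def by linarith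
      moreover from hook_length_beta[OF part this] b have "hook_length lam a b = e" by linarith
      ultimately show False using core by blast
    qed
  next
    fix a b assume closed: "\<forall>a. beta lam a - int e \<in> range (beta lam)" and b: "b < lam a"
    have "beta lam a - int (hook_length lam a b) \<notin> range (beta lam)"
      unfolding not_beta_iff[OF part] hook_length_beta[OF part b] by (intro exI[of _ b]) simp
    then show "hook_length lam a b \<noteq> e" using closed by auto
  qed
  then show ?thesis using part by (auto simp: e_core_def)
qed (simp add: e_core_def)

text \<open>An addable node gives a bead \<open>x\<close> with \<open>x + 1\<close> vacant, a
  removable one a bead \<open>y + 1\<close> with \<open>y\<close> vacant, where \<open>x\<close> and
  \<open>y\<close> lie on the same runner. If \<open>y \<le> x\<close>, the bead \<open>x\<close>
  forces a bead at \<open>y\<close>; otherwise the bead \<open>y + 1\<close> forces one at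
  \<open>x + 1\<close>.\<close>

lemma pure_e_core:
  assumes "e > 0" "e_core e lam"
  shows "pure e m i lam"
proof -
  have part: "partition lam" and closed: "\<And>x. x \<in> range (beta lam) \<Longrightarrow> x - int e \<in> range (beta lam)"
    using assms e_core_iff_beta by blast+
  have closed': "x - int n * int e \<in> range (beta lam)" if "x \<in> range (beta lam)" for n x
  proof (induction n)
    case (Suc n)
    then show ?case using closed[of "x - int n * int e"] by (simp add: algebra_simps)
  qed (use that in simp)
  have down: "y \<in> range (beta lam)" if x: "x \<in> range (beta lam)" and xy: "[x = y] (mod int e)" "y \<le> x" for x y
  proof -
    obtain k where k: "x - y = int e * k" using xy(1) by (metis cong_iff_dvd_diff dvdE)
    then have "k \<ge> 0" using xy(2) assms(1) by (metis diff_ge_0_iff_ge of_nat_0_less_iff zero_le_mult_iff not_le)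
    then have "y = x - int (nat k) * int e" using k by (simp add: algebra_simps)
    then show ?thesis using closed'[OF x, of "nat k"] by metis
  qed
  have False if a: "addable e m i lam a" and b: "removable e m i lam b" for a b
  proof -
    have a': "[beta lam a = i - m] (mod int e)" "beta lam a + 1 \<notin> range (beta lam)"
      and b': "[beta lam b - 1 = i - m] (mod int e)" "beta lam b - 1 \<notin> range (beta lam)"
      using a b addable_beta[OF part] removable_beta[OF part] by auto
    have c: "[beta lam a = beta lam b - 1] (mod int e)" using a'(1) b'(1) by (metis cong_sym cong_trans)
    then have c': "[beta lam b = beta lam a + 1] (mod int e)"
      by (metis cong_add_rcancel cong_sym diff_add_cancel)
    show False
    proof (cases "beta lam b - 1 \<le> beta lam a")
      case True
      then show ?thesis using down[OF _ c] b'(2) by blast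
    next
      case False
      then show ?thesis using down[OF _ c'] a'(2) by auto
    qed
  qed
  then show ?thesis using part by (auto simp: pure_def)
qed

section \<open>Adding all addable nodes of one residue to a core\<close>

definition add_all :: "nat \<Rightarrow> int \<Rightarrow> int \<Rightarrow> part \<Rightarrow> part" where
  "add_all e m i lam = (\<lambda>a. lam a + (if addable e m i lam a then 1 else 0))"

lemma add_all_id: "partition lam \<Longrightarrow> num_add e m i lam = 0 \<Longrightarrow> add_all e m i lam = lam"
  using set_addable_rows[of lam e m i] by (auto simp: add_all_def)

lemma partition_add_all:
  assumes "partition lam"
  shows "partition (add_all e m i lam)"
proof -
  have "add_all e m i lam (Suc a) \<le> add_all e m i lam a" for a
    using partition_antimono[OF assms, of a "Suc a"] by (auto simp: add_all_def addable_def)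
  moreover have "add_all e m i lam a = 0" if "a \<ge> Suc (plength lam)" for a
    using row_le_plength[OF assms, of e m i a] row_eq_0_iff[OF assms, of a] that
    by (auto simp: add_all_def)
  ultimately show ?thesis unfolding partition_iff by blast
qed

text \<open>If something can be added, then no \<open>i\<close>-node is removable, and adding all
  addable ones interchanges two neighbouring runners: a simple reflection of the affine Weyl
  group.\<close>

lemma e_core_add_all:
  assumes "e \<ge> 2" "e_core e lam"
  shows "e_core e (add_all e m i lam)"
proof (cases "\<exists>a. addable e m i lam a")
  case False
  then show ?thesis using assms(2) by (simp add: add_all_def)
next
  case True
  have part: "partition lam" and closed: "\<And>x. x \<in> range (beta lam) \<Longrightarrow> x - int e \<in> range (beta lam)"
    using assms e_core_iff_beta[of e lam] by auto
  have nrem: "\<not> removable e m i lam a" for a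
    using True pure_e_core[of e lam m i] assms by (auto simp: pure_def)
  let ?X = "range (beta lam)"
  define c where "c = i - m"
  \<comment> \<open>The interchange of the runners of \<open>c\<close> and \<open>c + 1\<close>. It
    commutes with the shift by \<open>e\<close>, hence preserves closure under this shift.\<close>
  define \<sigma> where "\<sigma> y = (if [y = c] (mod int e) then y + 1
    else if [y - 1 = c] (mod int e) then y - 1 else y)" for y
  have excl: "\<not> ([y = c] (mod int e) \<and> [y - 1 = c] (mod int e))" for y
    using cong_off_by_one[OF assms(1), of y c "y - 1"] by auto
  have beta_add: "beta (add_all e m i lam) a =
      (if [beta lam a = c] (mod int e) \<and> beta lam a + 1 \<notin> ?X then beta lam a + 1 else beta lam a)" for a
    using addable_beta[OF part, of e m i a] by (auto simp: beta_def add_all_def c_def)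
  \<comment> \<open>Absence of removable \<open>i\<close>-nodes: each bead on the upper runner has a
    bead as its left neighbour.\<close>
  have up: "beta lam a - 1 \<in> ?X" if "[beta lam a - 1 = c] (mod int e)" for a
    using nrem[of a] removable_beta[OF part, of e m i a] that by (auto simp: c_def)
  have X': "y \<in> range (beta (add_all e m i lam)) \<longleftrightarrow> \<sigma> y \<in> ?X" for y
  proof
    assume "y \<in> range (beta (add_all e m i lam))"
    then obtain a where a: "y = beta (add_all e m i lam) a" by auto
    show "\<sigma> y \<in> ?X"
    proof (cases "[beta lam a = c] (mod int e) \<and> beta lam a + 1 \<notin> ?X")
      case True
      then have "y = beta lam a + 1" using a by (simp add: beta_add)
      then show ?thesis using True excl[of y] by (simp add: \<sigma>_def)
    next
      case False
      then have "y = beta lam a" using a by (simp add: beta_add)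
      then show ?thesis using False up[of a] by (simp add: \<sigma>_def)
    qed
  next
    assume "\<sigma> y \<in> ?X"
    then obtain a where a: "\<sigma> y = beta lam a" by auto
    consider "[y = c] (mod int e)" | "[y - 1 = c] (mod int e)" "\<not> [y = c] (mod int e)"
      | "\<not> [y = c] (mod int e)" "\<not> [y - 1 = c] (mod int e)" by blast
    then show "y \<in> range (beta (add_all e m i lam))"
    proof cases
      case 1
      then have "beta lam a = y + 1" using a by (simp add: \<sigma>_def)
      then obtain b where "y = beta lam b" using up[of a] 1 by auto
      moreover have "y + 1 \<in> ?X" using \<open>beta lam a = y + 1\<close> by (metis rangeI)
      ultimately have "y = beta (add_all e m i lam) b" by (simp add: beta_add)
      then show ?thesis by simp
    next
      case 2
      then have ya: "beta lam a = y - 1" using a by (simp add: \<sigma>_def)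
      show ?thesis
      proof (cases "y \<in> ?X")
        case True
        then obtain b where "y = beta lam b" by auto
        then have "y = beta (add_all e m i lam) b" using 2 by (simp add: beta_add)
        then show ?thesis by simp
      next
        case False
        then have "y = beta (add_all e m i lam) a" using ya 2 by (simp add: beta_add)
        then show ?thesis by simp
      qed
    next
      case 3
      then have "y = beta lam a" using a by (simp add: \<sigma>_def)
      then have "y = beta (add_all e m i lam) a" using 3 by (simp add: beta_add)
      then show ?thesis by simp
    qed
  qed
  have "[y - int e = c] (mod int e) \<longleftrightarrow> [y = c] (mod int e)" for y by (simp add: cong_def)
  moreover from this have "[y - int e - 1 = c] (mod int e) \<longleftrightarrow> [y - 1 = c] (mod int e)" for y
    by (metis diff_diff_eq add.commute)
  ultimately have "\<sigma> (y - int e) = \<sigma> y - int e" for y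
    by (simp add: \<sigma>_def)
  then have "y - int e \<in> range (beta (add_all e m i lam))" if "y \<in> range (beta (add_all e m i lam))" for y
    using closed[of "\<sigma> y"] that by (simp only: X')
  then show ?thesis
    using partition_add_all[OF part] assms(1) e_core_iff_beta[of e "add_all e m i lam"] by auto
qed

lemma e_core_empty_part: "e_core e empty_part"
  unfolding e_core_def using partition_empty_part by (simp add: empty_part_def)

section \<open>Conjugation of cores, residues, addable and removable nodes\<close>

lemma e_core_conj_part:
  assumes "e_core e lam"
  shows "e_core e (conj_part lam)"
proof -
  have part: "partition lam" using assms by (simp add: e_core_def)
  have "hook_length (conj_part lam) b a = hook_length lam a b" for a b
    by (simp add: hook_length_def conj_conj_part[OF part])
  then show ?thesis
    using assms partition_conj_part[OF part] less_conj_part[OF part] by (simp add: e_core_def)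
qed

text \<open>Transposition changes the sign of the content, hence that of the residue relative to
  \<open>m\<close>.\<close>

lemma has_residue_conj: "has_residue e m (m - j) b a \<longleftrightarrow> has_residue e m (m + j) a b"
proof -
  have "has_residue e m (m - j) b a \<longleftrightarrow> [- (int b - int a) = - j] (mod int e)"
    by (simp add: has_residue_alt)
  then show ?thesis by (simp only: cong_minus_minus_iff) (simp add: has_residue_alt)
qed

lemma addable_conj:
  assumes "partition lam" "addable e m (m + j) lam a"
  shows "conj_part lam (lam a) = a" "addable e m (m - j) (conj_part lam) (lam a)"
proof -
  have "\<not> a < conj_part lam (lam a)" by (simp add: less_conj_part[OF assms(1)])
  moreover have "a = 0 \<or> a - 1 < conj_part lam (lam a)"
    using assms(2) by (simp add: less_conj_part[OF assms(1)] addable_def)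
  ultimately show eq: "conj_part lam (lam a) = a" by linarith
  have "lam a = 0 \<or> a < conj_part lam (lam a - 1)"
    by (auto simp: less_conj_part[OF assms(1)])
  then show "addable e m (m - j) (conj_part lam) (lam a)"
    using assms(2) by (simp add: addable_def eq has_residue_conj)
qed

lemma removable_conj:
  assumes "partition lam" "removable e m (m + j) lam a"
  shows "conj_part lam (lam a - 1) = Suc a" "removable e m (m - j) (conj_part lam) (lam a - 1)"
proof -
  have "a < conj_part lam (lam a - 1)" "\<not> Suc a < conj_part lam (lam a - 1)"
    using assms(2) by (auto simp: less_conj_part[OF assms(1)] removable_def)
  then show eq: "conj_part lam (lam a - 1) = Suc a" by linarith
  moreover have "\<not> a < conj_part lam (lam a)" by (simp add: less_conj_part[OF assms(1)])
  moreover have "Suc (lam a - 1) = lam a" using assms(2) by (simp add: removable_def)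
  ultimately have "conj_part lam (Suc (lam a - 1)) < conj_part lam (lam a - 1)" by simp
  then show "removable e m (m - j) (conj_part lam) (lam a - 1)"
    using assms(2) unfolding removable_def by (simp only: eq has_residue_conj) simp
qed

text \<open>Sending the row of an addable node to its column is a bijection, whose inverse is given
  by the conjugate partition.\<close>

lemma num_add_conj:
  assumes "partition lam"
  shows "num_add e m (m - j) (conj_part lam) = num_add e m (m + j) lam"
proof -
  have "bij_betw lam {a. addable e m (m + j) lam a} {b. addable e m (m - j) (conj_part lam) b}"
    using addable_conj[OF assms, of e m j]
      addable_conj[OF partition_conj_part[OF assms], of e m "- j"]
    by (intro bij_betw_byWitness[where f' = "conj_part lam"])
      (auto simp: conj_conj_part[OF assms])
  from bij_betw_same_card[OF this] show ?thesis
    by (simp add: num_add_card assms partition_conj_part)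
qed

lemma num_rem_conj:
  assumes "partition lam"
  shows "num_rem e m (m - j) (conj_part lam) = num_rem e m (m + j) lam"
proof -
  have "bij_betw (\<lambda>a. lam a - 1) {a. removable e m (m + j) lam a}
      {b. removable e m (m - j) (conj_part lam) b}"
    using removable_conj[OF assms, of e m j]
      removable_conj[OF partition_conj_part[OF assms], of e m "- j"]
    by (intro bij_betw_byWitness[where f' = "\<lambda>b. conj_part lam b - 1"])
      (auto simp: conj_conj_part[OF assms])
  from bij_betw_same_card[OF this] show ?thesis
    by (simp add: num_rem_card assms partition_conj_part)
qed

lemma add_all_conj:
  assumes "partition lam"
  shows "add_all e m (m - j) (conj_part lam) = conj_part (add_all e m (m + j) lam)"
proof (rule part_eqI)
  fix b a
  have "a < add_all e m (m - j) (conj_part lam) b \<longleftrightarrow> a < conj_part lam b \<or>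
      (a = conj_part lam b \<and> addable e m (m - j) (conj_part lam) b)"
    by (auto simp: add_all_def)
  also have "\<dots> \<longleftrightarrow> b < lam a \<or> (b = lam a \<and> addable e m (m + j) lam a)"
    using addable_conj[OF assms, of e m j a]
      addable_conj[OF partition_conj_part[OF assms], of e m "- j" b]
    by (auto simp: conj_conj_part[OF assms] less_conj_part[OF assms])
  also have "\<dots> \<longleftrightarrow> b < add_all e m (m + j) lam a"
    by (auto simp: add_all_def)
  finally show "a < add_all e m (m - j) (conj_part lam) b \<longleftrightarrow>
      a < conj_part (add_all e m (m + j) lam) b"
    by (simp add: less_conj_part partition_add_all assms)
qed

section \<open>Crystal morphisms along a word\<close>

definition stretch :: "nat \<Rightarrow> 'a list \<Rightarrow> 'a list" where
  "stretch n xs = concat (map (replicate n) xs)"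

lemma stretch_simps [simp]:
  "stretch n [] = []"
  "stretch n (x # xs) = replicate n x @ stretch n xs"
  "stretch n (xs @ ys) = stretch n xs @ stretch n ys"
  by (simp_all add: stretch_def)

lemma stretch_1: "stretch (Suc 0) xs = xs"
  by (induction xs) auto

lemma rev_stretch: "rev (stretch n xs) = stretch n (rev xs)"
  by (induction xs) auto

lemma set_stretch: "set (stretch n xs) \<subseteq> set xs"
  by (auto simp: stretch_def)

lemma stretch_replicate: "stretch n (replicate c x) = replicate (n * c) x"
  by (induction c) (auto simp: replicate_add)

lemma sorted_stretch:
  fixes xs :: "'a :: preorder list"
  assumes "sorted_wrt (\<le>) xs"
  shows "sorted_wrt (\<le>) (stretch n xs)"
  using assms
proof (induction xs)
  case (Cons x xs)
  have "sorted_wrt (\<le>) (replicate n x)" by (induction n) auto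
  then show ?case using Cons set_stretch[of n xs] by (auto simp: sorted_wrt_append)
qed simp

text \<open>Each factor stands for \<open>M\<close> copies. The \<open>r\<close> skipped places use
  up whole copies first, the remaining copies are filled completely. If nothing is addable, then
  \<open>r div 0 = 0\<close> puts all copies into the second block, where \<open>add_all\<close>
  does not change them.\<close>

fun fill_blocks :: "nat \<Rightarrow> int \<Rightarrow> int \<Rightarrow> nat \<Rightarrow> nat \<Rightarrow> part list \<Rightarrow> part list" where
  "fill_blocks e m i M r [] = []"
| "fill_blocks e m i M r (x # xs) =
     replicate (min M (r div num_add e m i x)) x @
     replicate (M - r div num_add e m i x) (add_all e m i x) @
     fill_blocks e m i M (r - M * num_add e m i x + M * num_rem e m i x) xs"

lemma length_fill_blocks: "length (fill_blocks e m i M r xs) = M * length xs"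
  by (induction xs arbitrary: r) auto

lemma pure_num:
  assumes "pure e m i x" "num_add e m i x > 0"
  shows "num_rem e m i x = 0"
proof -
  have part: "partition x" using assms(1) by (simp add: pure_def)
  have "set (addable_rows e m i x) \<noteq> {}" using assms(2) by simp
  then have "\<exists>a. addable e m i x a" unfolding set_addable_rows[OF part] by blast
  then have "set (removable_rows e m i x) = {}"
    unfolding set_removable_rows[OF part] using assms(1) by (simp add: pure_def)
  then show ?thesis by simp
qed

text \<open>Divisibility makes the skipped places end between two copies, so no copy is filled
  partially.\<close>

lemma fill_reading_replicate:
  assumes "pure e m i x" "num_add e m i x > 0 \<longrightarrow> num_add e m i x dvd r"
  shows "fill_reading e m i r (replicate n x @ ys) =
    replicate (min n (r div num_add e m i x)) x @
    replicate (n - r div num_add e m i x) (add_all e m i x) @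
    fill_reading e m i (r - n * num_add e m i x + n * num_rem e m i x) ys"
proof (cases "num_add e m i x = 0")
  case True
  have part: "partition x" using assms(1) by (simp add: pure_def)
  show ?thesis
    using True add_all_id[OF part True]
    by (induction n arbitrary: r) (auto simp: algebra_simps)
next
  case False
  define p where "p = num_add e m i x"
  have p: "p > 0" "p dvd r" using False assms(2) by (auto simp: p_def)
  have q: "num_rem e m i x = 0" using pure_num[OF assms(1)] False by simp
  have all: "(\<lambda>a. x a + (if a \<in> set (addable_rows e m i x) then 1 else 0)) = add_all e m i x"
    using assms(1) by (auto simp: pure_def set_addable_rows add_all_def)
  have "fill_reading e m i r (replicate n x @ ys) =
    replicate (min n (r div p)) x @ replicate (n - r div p) (add_all e m i x) @
    fill_reading e m i (r - n * p) ys"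
    using p(2)
  proof (induction n arbitrary: r)
    case (Suc n)
    show ?case
    proof (cases "r = 0")
      case True
      then show ?thesis using Suc.IH[of 0] by (simp add: all q)
    next
      case False
      then obtain t where t: "r = p * Suc t" using Suc.prems by (metis dvdE mult_0_right not0_implies_Suc)
      then have "drop r (addable_rows e m i x) = []" by (simp add: p_def)
      moreover have "r - p = p * t" "r div p = Suc t" using t p(1) by auto
      ultimately show ?thesis
        using Suc.IH[of "p * t"] p(1) t by (simp add: q p_def[symmetric] diff_diff_left algebra_simps)
    qed
  qed simp
  then show ?thesis by (simp add: q p_def)
qed

text \<open>All block lengths are homogeneous in \<open>r\<close> and the multiplicities, so a
  factor \<open>n\<close> can be taken out. The condition \<open>M dvd r\<close> reproduces itself,
  since each factor changes \<open>r\<close> by multiples of \<open>M\<close> only.\<close>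

lemma fill_reading_stretch:
  assumes "\<forall>x \<in> set xs. pure e m i x \<and> (num_add e m i x > 0 \<longrightarrow> num_add e m i x dvd M)" "M dvd r"
  shows "fill_reading e m i (n * r) (stretch (n * M) xs) = stretch n (fill_blocks e m i M r xs)"
  using assms
proof (induction xs arbitrary: r)
  case (Cons x xs)
  let ?p = "num_add e m i x" and ?q = "num_rem e m i x"
  have p: "?p > 0 \<longrightarrow> ?p dvd r" using Cons.prems by (meson dvd_trans list.set_intros(1))
  then have div: "(n * r) div ?p = n * (r div ?p)" by (cases "?p = 0") (auto simp: div_mult_swap)
  have "fill_reading e m i (n * r) (stretch (n * M) (x # xs)) =
      replicate (min (n * M) (n * (r div ?p))) x @
      replicate (n * M - n * (r div ?p)) (add_all e m i x) @
      fill_reading e m i (n * r - n * M * ?p + n * M * ?q) (stretch (n * M) xs)"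
    using fill_reading_replicate[of e m i x "n * r" "n * M"] Cons.prems(1) p by (simp add: div)
  also have "min (n * M) (n * (r div ?p)) = n * min M (r div ?p)"
    by (simp add: min_def)
  also have "n * M - n * (r div ?p) = n * (M - r div ?p)"
    by (simp add: diff_mult_distrib2)
  also have "n * r - n * M * ?p + n * M * ?q = n * (r - M * ?p + M * ?q)"
    by (simp add: diff_mult_distrib2 distrib_left mult.assoc)
  also have "fill_reading e m i \<dots> (stretch (n * M) xs) =
      stretch n (fill_blocks e m i M (r - M * ?p + M * ?q) xs)"
    using Cons.prems by (intro Cons.IH) auto
  finally show ?case by (simp add: stretch_replicate)
qed simp

text \<open>Inclusion is in danger only in a row where \<open>x\<close> grows and both rows have
  equal length. Then \<open>x\<close> has used up the skipped places and has no \<open>SR\<close>,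
  so \<open>y\<close> is filled completely, and the same place is addable in
  \<open>y\<close>.\<close>

lemma fill_reading_mono_step:
  assumes "pure e m i x" "partition y" "x \<le> y"
  shows "(\<lambda>a. x a + (if a \<in> set (drop r (addable_rows e m i x)) then 1 else 0)) \<le>
    (\<lambda>a. y a + (if a \<in> set (drop (r - num_add e m i x + num_rem e m i x) (addable_rows e m i y)) then 1 else 0))"
proof (rule le_funI)
  fix a
  have xy: "x b \<le> y b" for b using assms(3) by (simp add: le_fun_def)
  show "x a + (if a \<in> set (drop r (addable_rows e m i x)) then 1 else 0) \<le>
    y a + (if a \<in> set (drop (r - num_add e m i x + num_rem e m i x) (addable_rows e m i y)) then 1 else 0)"
  proof (cases "a \<in> set (drop r (addable_rows e m i x)) \<and> x a = y a")
    case True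
    then have "drop r (addable_rows e m i x) \<noteq> []" by auto
    then have r: "r < num_add e m i x" by simp
    then have "num_add e m i x > 0" by linarith
    from pure_num[OF assms(1) this] have q: "num_rem e m i x = 0" .
    have "addable e m i x a"
      using True set_addable_rows[of x] assms(1) in_set_dropD by (fastforce simp: pure_def)
    then have "addable e m i y a"
      using True xy[of "a - 1"] by (auto simp: addable_def)
    then show ?thesis using True r q set_addable_rows[OF assms(2)] by simp
  next
    case False
    then show ?thesis using xy[of a] by auto
  qed
qed

lemma sorted_fill_reading:
  assumes "\<forall>x \<in> set xs. pure e m i x" "sorted_wrt (\<le>) xs"
  shows "sorted_wrt (\<le>) (fill_reading e m i r xs)"
  using assms
proof (induction xs arbitrary: r)
  case (Cons x xs)
  have IH: "sorted_wrt (\<le>) (fill_reading e m i r xs)" for r using Cons by simp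
  show ?case
  proof (cases xs)
    case (Cons y ys)
    then have "pure e m i x" "pure e m i y" "x \<le> y" using Cons.prems by auto
    then show ?thesis
      using fill_reading_mono_step[of e m i x y r] IH[of "r - num_add e m i x + num_rem e m i x"]
      unfolding Cons by (simp add: sorted_wrt2 pure_def del: sorted_wrt.simps)
  qed simp
qed simp

text \<open>The case \<open>n = 1\<close> of \<open>fill_reading_stretch\<close> transfers the order
  from the copy-by-copy description to the blocks.\<close>

lemma sorted_fill_blocks:
  assumes "\<forall>x \<in> set xs. pure e m i x \<and> (num_add e m i x > 0 \<longrightarrow> num_add e m i x dvd M)" "M dvd r"
    and "sorted_wrt (\<le>) xs"
  shows "sorted_wrt (\<le>) (fill_blocks e m i M r xs)"
proof -
  have "sorted_wrt (\<le>) (fill_reading e m i r (stretch M xs))"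
    using assms(1) set_stretch[of M xs] by (intro sorted_fill_reading sorted_stretch assms(3)) auto
  then show ?thesis using fill_reading_stretch[OF assms(1,2), of 1] by (simp add: stretch_1)
qed

lemma e_core_fill_blocks:
  assumes "e \<ge> 2" "\<forall>x \<in> set xs. e_core e x"
  shows "\<forall>x \<in> set (fill_blocks e m i M r xs). e_core e x"
  using assms(2) e_core_add_all[OF assms(1)] by (induction xs arbitrary: r) auto

lemma fill_blocks_conj:
  assumes "\<forall>x \<in> set xs. partition x"
  shows "fill_blocks e m (m - j) M r (map conj_part xs) = map conj_part (fill_blocks e m (m + j) M r xs)"
  using assms
  by (induction xs arbitrary: r) (auto simp: num_add_conj num_rem_conj add_all_conj)

lemma num_unmatched_conj:
  assumes "\<forall>x \<in> set xs. partition x"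
  shows "num_unmatched e m (m - j) r (map conj_part xs) = num_unmatched e m (m + j) r xs"
  using assms by (induction xs arbitrary: r) (auto simp: num_add_conj num_rem_conj)

text \<open>The list \<open>xs\<close> holds the factors in reading order.\<close>

definition stretches :: "(nat \<Rightarrow> part \<Rightarrow> part list) \<Rightarrow> part \<Rightarrow> part list \<Rightarrow> bool" where
  "stretches S lam xs \<longleftrightarrow> xs \<noteq> [] \<and> (\<forall>n\<ge>1. S (length xs * n) lam = rev (stretch n xs))"

lemma amplitude_morphismD:
  assumes "amplitude_morphism e m h T" "e_restricted e lam"
  shows "phi e m i (T lam) = h * phi e m i [lam]"
    and "map_option T (ftilde_part e m i lam) = iter_option h (ftilde e m i) (T lam)"
  using assms by (auto simp: amplitude_morphism_def)

text \<open>The amplitude condition expresses \<open>phi\<close> by a count that depends on the list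
  of cores alone. This permits comparing \<open>phi\<close> at two elements with conjugate
  lists.\<close>

lemma phi_stretches:
  assumes "e \<ge> 2" "\<And>h. h \<ge> 1 \<Longrightarrow> amplitude_morphism e m h (S h)" "e_restricted e lam"
    and "stretches S lam xs" "\<forall>x \<in> set xs. e_core e x" "n \<ge> 1"
  shows "num_unmatched e m i 0 (stretch n xs) = length xs * n * phi e m i [lam]"
proof -
  have h: "length xs * n \<ge> 1" using assms(4,6) by (simp add: stretches_def Suc_le_eq)
  have S: "S (length xs * n) lam = rev (stretch n xs)" using assms(4,6) by (simp add: stretches_def)
  have "\<forall>x \<in> set (rev (stretch n xs)). pure e m i x"
    using assms(1,5) set_stretch[of n xs] pure_e_core[of e] by auto
  from length_unmatched_A[OF this, of 0]
  have "num_unmatched e m i 0 (stretch n xs) = phi e m i (rev (stretch n xs))"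
    by (simp add: phi_def remaining_SA)
  also have "\<dots> = length xs * n * phi e m i [lam]"
    using amplitude_morphismD(1)[OF assms(2)[OF h] assms(3), of i] by (simp only: S)
  finally show ?thesis .
qed

text \<open>Of the \<open>h * phi\<close> survivors the last \<open>h\<close> are filled and
  \<open>h * (phi - 1)\<close> are skipped. For \<open>h = length xs * M * n\<close> the latter is
  \<open>n\<close> times a multiple of \<open>M\<close> that does not depend on \<open>n\<close>, so
  one new list serves all \<open>n\<close>.\<close>

lemma stretches_ftilde_part:
  assumes "e \<ge> 2" "\<And>h. h \<ge> 1 \<Longrightarrow> amplitude_morphism e m h (S h)" "e_restricted e lam"
    and "stretches S lam xs" "\<forall>x \<in> set xs. e_core e x"
    and "ftilde_part e m i lam = Some lam'"
    and M: "M > 0" "\<forall>x \<in> set xs. num_add e m i x > 0 \<longrightarrow> num_add e m i x dvd M"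
  shows "stretches S lam' (fill_blocks e m i M (length xs * M * (phi e m i [lam] - 1)) xs)"
proof -
  define r where "r = length xs * M * (phi e m i [lam] - 1)"
  have phi: "phi e m i [lam] \<ge> 1"
    using assms(6) by (auto simp: ftilde_part_def ftilde_def phi_def Suc_le_eq split: if_splits)
  have pure: "\<forall>x \<in> set xs. pure e m i x"
    using assms(1,5) pure_e_core[of e] by auto
  have "S (length xs * M * n) lam' = rev (stretch n (fill_blocks e m i M r xs))" if n: "n \<ge> 1" for n
  proof -
    define h where "h = length xs * M * n"
    have h: "h \<ge> 1" using assms(4) n M(1) by (simp add: stretches_def Suc_le_eq h_def)
    have "n * M \<ge> 1" "h = length xs * (n * M)" using n M(1) by (simp_all add: h_def Suc_le_eq)
    then have S: "S h lam = rev (stretch (n * M) xs)"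
      using assms(4) by (simp add: stretches_def)
    have num: "num_unmatched e m i 0 (stretch (n * M) xs) = h * phi e m i [lam]"
      using phi_stretches[OF assms(1-5), of "n * M" i] n M(1) by (simp add: h_def Suc_le_eq mult_ac)
    have diff: "h * phi e m i [lam] - h = n * r"
      by (simp add: h_def r_def diff_mult_distrib2 mult_ac)
    have le: "h \<le> h * phi e m i [lam]" using phi by simp
    have "Some (S h lam') = iter_option h (ftilde e m i) (rev (stretch (n * M) xs))"
      using amplitude_morphismD(2)[OF assms(2)[OF h] assms(3), of i] by (simp add: S assms(6))
    also have "\<dots> = Some (rev (fill_reading e m i (n * r) (stretch (n * M) xs)))"
      using iter_ftilde_pure[OF assms(1), of "rev (stretch (n * M) xs)" m i h]
        pure set_stretch[of "n * M" xs] le by (auto simp: num diff)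
    also have "fill_reading e m i (n * r) (stretch (n * M) xs) = stretch n (fill_blocks e m i M r xs)"
      using pure M(2) by (intro fill_reading_stretch) (auto simp: r_def)
    finally show ?thesis by (simp add: h_def)
  qed
  moreover have "length (fill_blocks e m i M r xs) > 0"
    using assms(4) M(1) by (simp add: length_fill_blocks stretches_def del: length_greater_0_conv) simp
  then have "fill_blocks e m i M r xs \<noteq> []" by auto
  ultimately show ?thesis
    unfolding stretches_def length_fill_blocks r_def[symmetric] by (simp add: mult.commute[of M])
qed

lemma e_restricted_empty_part: "e > 0 \<Longrightarrow> e_restricted e empty_part"
  by (simp add: e_restricted_def partition_empty_part) (simp add: empty_part_def)

lemma stretches_f_word:
  assumes e: "e \<ge> 2" and ampl: "\<And>h. h \<ge> 1 \<Longrightarrow> amplitude_morphism e m h (S h)"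
    and "f_word e m (map (\<lambda>j. m + j) js) = Some lam" "f_word e m (map (\<lambda>j. m - j) js) = Some mu"
  shows "e_restricted e lam \<and> e_restricted e mu \<and>
    (\<exists>xs. stretches S lam xs \<and> stretches S mu (map conj_part xs) \<and>
      (\<forall>x \<in> set xs. e_core e x) \<and> sorted_wrt (\<le>) xs)"
  using assms(3,4)
proof (induction js arbitrary: lam mu)
  case Nil
  then have eq: "lam = empty_part" "mu = empty_part" by (auto simp: f_word_def)
  have "stretches S empty_part [empty_part]"
    using ampl by (simp add: stretches_def amplitude_morphism_def)
  then show ?case
    using e e_restricted_empty_part e_core_empty_part
    by (auto simp: eq conj_empty_part intro!: exI[of _ "[empty_part]"])
next
  case (Cons j js)
  obtain lam0 where lam0: "f_word e m (map (\<lambda>j. m + j) js) = Some lam0" "ftilde_part e m (m + j) lam0 = Some lam"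
    using Cons.prems(1) by (auto simp: f_word_def bind_eq_Some_conv)
  obtain mu0 where mu0: "f_word e m (map (\<lambda>j. m - j) js) = Some mu0" "ftilde_part e m (m - j) mu0 = Some mu"
    using Cons.prems(2) by (auto simp: f_word_def bind_eq_Some_conv)
  from Cons.IH[OF lam0(1) mu0(1)] obtain xs where re: "e_restricted e lam0" "e_restricted e mu0"
    and st: "stretches S lam0 xs" "stretches S mu0 (map conj_part xs)"
    and core: "\<forall>x \<in> set xs. e_core e x" and sorted: "sorted_wrt (\<le>) xs" by blast
  have part: "\<forall>x \<in> set xs. partition x" using core by (simp add: e_core_def)
  have core': "\<forall>x \<in> set (map conj_part xs). e_core e x" using core e_core_conj_part by auto
  have ne: "xs \<noteq> []" using st by (simp add: stretches_def)
  \<comment> \<open>A common multiple of the positive numbers of addable nodes; \<open>max 1\<close>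
    keeps the product nonzero. By conjugation the same \<open>M\<close> works for both
    words.\<close>
  define M where "M = (\<Prod>x\<leftarrow>xs. max 1 (num_add e m (m + j) x))"
  have M0: "M > 0" unfolding M_def by (induction xs) auto
  have "max 1 (num_add e m (m + j) x) dvd M" if "x \<in> set xs" for x
    using that unfolding M_def by (intro prod_list_dvd) simp
  then have M: "\<forall>x \<in> set xs. num_add e m (m + j) x > 0 \<longrightarrow> num_add e m (m + j) x dvd M"
    by (metis Suc_leI max.absorb2 One_nat_def)
  then have M': "\<forall>x \<in> set (map conj_part xs). num_add e m (m - j) x > 0 \<longrightarrow> num_add e m (m - j) x dvd M"
    using part by (simp add: num_add_conj del: length_greater_0_conv)
  \<comment> \<open>Equal values of \<open>phi\<close> give both words the same number of skipped
    places, hence parallel block decompositions.\<close>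
  have "length xs * phi e m (m + j) [lam0] = length xs * phi e m (m - j) [mu0]"
    using phi_stretches[OF e ampl re(1) st(1) core, of 1 "m + j"]
      phi_stretches[OF e ampl re(2) st(2) core', of 1 "m - j"] part
    by (simp add: stretch_1 num_unmatched_conj)
  then have phi: "phi e m (m - j) [mu0] = phi e m (m + j) [lam0]" using ne by simp
  define r where "r = length xs * M * (phi e m (m + j) [lam0] - 1)"
  let ?ys = "fill_blocks e m (m + j) M r xs"
  have "stretches S lam ?ys"
    unfolding r_def by (rule stretches_ftilde_part[OF e ampl re(1) st(1) core lam0(2) M0 M])
  moreover have "stretches S mu (map conj_part ?ys)"
    using stretches_ftilde_part[OF e ampl re(2) st(2) core' mu0(2) M0 M'] part
    by (simp add: phi r_def fill_blocks_conj)
  moreover have "sorted_wrt (\<le>) ?ys"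
    using core M pure_e_core[of e] e sorted by (intro sorted_fill_blocks) (auto simp: r_def)
  moreover have "\<forall>x \<in> set ?ys. e_core e x" by (rule e_core_fill_blocks[OF e core])
  moreover have "e_restricted e lam" "e_restricted e mu"
    using e_restricted_ftilde_part[OF e] re lam0(2) mu0(2) by blast+
  ultimately show ?case by blast
qed

section \<open>Ceiling and floor\<close>

text \<open>In a monotone chain an entry that has been left cannot return, by antisymmetry; so the
  values of different runs are distinct.\<close>

lemma ex_runs:
  fixes zs :: "'a :: order list"
  assumes "sorted_wrt (\<ge>) zs" "zs \<noteq> []"
  shows "\<exists>cs nus. length cs = length nus \<and> (\<forall>c \<in> set cs. 0 < c) \<and> distinct nus \<and>
    set nus = set zs \<and> hd nus = hd zs \<and> zs = concat (map2 replicate cs nus)"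
  using assms
proof (induction zs)
  case (Cons z zs)
  show ?case
  proof (cases zs)
    case Nil
    then show ?thesis by (intro exI[of _ "[1]"] exI[of _ "[z]"]) simp
  next
    case (Cons z' zs')
    have "sorted_wrt (\<ge>) zs" "zs \<noteq> []" using Cons.prems Cons by simp_all
    from Cons.IH[OF this] obtain cs nus where *: "length cs = length nus" "\<forall>c \<in> set cs. 0 < c"
      "distinct nus" "set nus = set zs" "hd nus = hd zs" "zs = concat (map2 replicate cs nus)"
      by blast
    have "nus \<noteq> []" using *(4) Cons by auto
    with *(1,5) obtain c cs' nus' where c: "cs = c # cs'" "nus = z' # nus'"
      by (metis Cons length_0_conv list.exhaust_sel list.sel(1))
    show ?thesis
    proof (cases "z = z'")
      case True
      then show ?thesis using * c
        by (intro exI[of _ "Suc c # cs'"] exI[of _ nus]) auto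
    next
      case False
      have "z \<notin> set zs"
      proof
        assume "z \<in> set zs"
        then have "z \<le> z'" using Cons.prems Cons by auto
        then show False using Cons.prems(1) Cons False by (simp add: order.antisym)
      qed
      then show ?thesis using *
        by (intro exI[of _ "1 # cs"] exI[of _ "z # nus"]) auto
    qed
  qed
qed simp

lemma stretch_runs:
  assumes "length cs = length nus"
  shows "stretch n (concat (map2 replicate cs nus)) = concat (map2 replicate (map ((*) n) cs) nus)"
  using assms by (induction cs nus rule: list_induct2) (auto simp: stretch_replicate)

lemma map_runs:
  assumes "length cs = length nus"
  shows "map f (concat (map2 replicate cs nus)) = concat (map2 replicate cs (map f nus))"
  using assms by (induction cs nus rule: list_induct2) auto

lemma hd_last_runs:
  assumes "length cs = length nus" "\<forall>c \<in> set cs. 0 < c" "nus \<noteq> []"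
  shows "concat (map2 replicate cs nus) \<noteq> []"
    and "hd (concat (map2 replicate cs nus)) = hd nus"
    and "last (concat (map2 replicate cs nus)) = last nus"
proof -
  have "nus \<noteq> [] \<longrightarrow> concat (map2 replicate cs nus) \<noteq> [] \<and>
    hd (concat (map2 replicate cs nus)) = hd nus \<and> last (concat (map2 replicate cs nus)) = last nus"
    using assms(1,2)
  proof (induction cs nus rule: list_induct2)
    case (Cons c cs nu nus)
    then show ?case by (cases "nus = []") (auto simp: last_append)
  qed simp
  then show "concat (map2 replicate cs nus) \<noteq> []"
    and "hd (concat (map2 replicate cs nus)) = hd nus"
    and "last (concat (map2 replicate cs nus)) = last nus"
    using assms(3) by auto
qed

text \<open>The breakpoints are the partial sums of the run lengths divided by their total, and this
  total serves as \<open>N\<close>.\<close>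

lemma core_factorization_runs:
  assumes "length cs = length nus" "\<forall>c \<in> set cs. 0 < c" "nus \<noteq> []" "distinct nus"
    and "\<forall>nu \<in> set nus. e_core e nu"
    and S: "\<And>n. n \<ge> 1 \<Longrightarrow> S (sum_list cs * n) lam = concat (map2 replicate (map ((*) n) cs) nus)"
  shows "\<exists>as. core_factorization e S lam as nus"
proof -
  define N where "N = sum_list cs"
  define B where "B k = (of_nat (sum_list (take k cs)) / of_nat N :: rat)" for k
  define as where "as = map B [1..<length cs]"
  have cs: "cs \<noteq> []" using assms(1,3) by auto
  then obtain c cs' where "cs = c # cs'" by (cases cs) auto
  with assms(2) have N: "N > 0" by (simp add: N_def)
  \<comment> \<open>The two outermost partial sums give 0 and 1, so \<open>as\<close> keeps only the
    inner ones.\<close>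
  have B: "0 # as @ [1] = map B [0..<Suc (length cs)]"
  proof -
    have "[0..<Suc (length cs)] = 0 # [1..<length cs] @ [length cs]"
      using cs by (simp add: upt_conv_Cons[of 0])
    moreover have "B 0 = 0" "B (length cs) = 1" using N by (simp_all add: B_def flip: N_def)
    ultimately show ?thesis by (simp add: as_def)
  qed
  have step: "B (Suc k) - B k = of_nat (cs ! k) / of_nat N" if "k < length cs" for k
    using that by (simp add: B_def take_Suc_conv_app_nth add_divide_distrib)
  have "sorted_wrt (<) (map B [0..<Suc (length cs)])"
    unfolding sorted_wrt_iff_nth_Suc_transp[OF transp_on_less]
  proof (intro allI impI)
    fix k assume "Suc k < length (map B [0..<Suc (length cs)])"
    then have k: "k < length cs" by simp
    then have "B (Suc k) - B k > 0" using assms(2) N by (simp add: step)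
    then show "map B [0..<Suc (length cs)] ! k < map B [0..<Suc (length cs)] ! Suc k"
      using k by (simp add: nth_append del: upt_Suc)
  qed
  moreover have "\<exists>c. length c = length nus \<and>
      (\<forall>j < length nus. of_nat (c ! j) = ((0 # as @ [1]) ! Suc j - (0 # as @ [1]) ! j) * of_nat h) \<and>
      S h lam = concat (map2 replicate c nus)" if h: "h > 0" "N dvd h" for h
  proof -
    obtain n where n: "h = N * n" using h(2) by blast
    have "of_nat (map ((*) n) cs ! j) =
        ((0 # as @ [1]) ! Suc j - (0 # as @ [1]) ! j) * (of_nat h :: rat)" if "j < length nus" for j
      using that assms(1) N by (simp only: B) (simp add: step n del: upt_Suc)
    moreover have "S h lam = concat (map2 replicate (map ((*) n) cs) nus)"
      using S[of n] h(1) by (simp add: n N_def Suc_le_eq)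
    ultimately show ?thesis using assms(1) by (intro exI[of _ "map ((*) n) cs"]) simp
  qed
  moreover have "length as = length cs - 1" by (simp add: as_def)
  then have "length nus = length as + 1" using cs assms(1) length_greater_0_conv[of cs] by linarith
  ultimately have "core_factorization e S lam as nus"
    unfolding core_factorization_def using assms(4,5) N B by metis
  then show ?thesis by blast
qed

text \<open>Strictly increasing breakpoints make every exponent positive, so no core of the list
  drops out of \<open>S h lam\<close>. Its two ends therefore determine those of
  \<open>nus\<close>.\<close>

lemma core_factorization_hd_last:
  assumes "core_factorization e S lam as nus"
  obtains N where "N > 0" "\<And>h. h > 0 \<Longrightarrow> N dvd h \<Longrightarrow> hd (S h lam) = hd nus \<and> last (S h lam) = last nus"
proof -
  let ?B = "0 # as @ [1]"
  have len: "length nus = length as + 1" and sorted: "sorted_wrt (<) ?B"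
    using assms by (auto simp: core_factorization_def)
  from assms obtain N where N: "N > 0" "\<And>h. h > 0 \<Longrightarrow> N dvd h \<Longrightarrow> \<exists>c. length c = length nus \<and>
      (\<forall>j < length nus. of_nat (c ! j) = (?B ! Suc j - ?B ! j) * of_nat h) \<and>
      S h lam = concat (map2 replicate c nus)"
    unfolding core_factorization_def by blast
  have "hd (S h lam) = hd nus \<and> last (S h lam) = last nus" if h: "h > 0" "N dvd h" for h
  proof -
    obtain c where c: "length c = length nus"
      "\<And>j. j < length nus \<Longrightarrow> of_nat (c ! j) = (?B ! Suc j - ?B ! j) * of_nat h"
      "S h lam = concat (map2 replicate c nus)"
      using N(2)[OF h] by blast
    have "c ! j > 0" if "j < length nus" for j
    proof -
      have "?B ! j < ?B ! Suc j" using sorted_wrt_nth_less[OF sorted, of j "Suc j"] that len by simp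
      then have "(of_nat (c ! j) :: rat) > 0" using c(2)[OF that] h(1) by simp
      then show ?thesis by simp
    qed
    then have "\<forall>x \<in> set c. 0 < x" using c(1) by (metis in_set_conv_nth)
    then show ?thesis using hd_last_runs[OF c(1)] len c(3) by (metis add_eq_0_iff_both_eq_0 list.size(3) zero_neq_one)
  qed
  then show ?thesis using that N(1) by blast
qed

lemma ceil_floor_part:
  assumes "core_factorization e S lam as nus"
  shows "ceil_part e S lam = hd nus" "floor_part e S lam = last nus"
proof -
  have "hd nus' = hd nus \<and> last nus' = last nus" if fac: "core_factorization e S lam as' nus'" for as' nus'
  proof -
    obtain N where N: "N > 0" "\<And>h. h > 0 \<Longrightarrow> N dvd h \<Longrightarrow> hd (S h lam) = hd nus \<and> last (S h lam) = last nus"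
      using core_factorization_hd_last[OF assms] by blast
    obtain N' where N': "N' > 0" "\<And>h. h > 0 \<Longrightarrow> N' dvd h \<Longrightarrow> hd (S h lam) = hd nus' \<and> last (S h lam) = last nus'"
      using core_factorization_hd_last[OF fac] by blast
    \<comment> \<open>The amplitude \<open>N * N'\<close> is admissible for both factorizations, so
      both are read off from the same tensor.\<close>
    show ?thesis using N(2)[of "N * N'"] N'(2)[of "N * N'"] N(1) N'(1) by simp
  qed
  then show "ceil_part e S lam = hd nus" "floor_part e S lam = last nus"
    unfolding ceil_part_def floor_part_def using assms by (blast intro: the_equality)+
qed

theorem proposition5p21:
  fixes e :: nat and m :: int
    and q :: "'F::alg_closed_field" and D :: "part \<Rightarrow> 'F hecke_mod"
    and S :: "nat \<Rightarrow> part \<Rightarrow> part list" and lam :: part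
  assumes "e \<ge> 2"
    and "has_mult_order q e"
    and "simple_labelling e q D"
    and "mullineux_by_crystal e m q D"
    and "\<And>h. h \<ge> 1 \<Longrightarrow> amplitude_morphism e m h (S h)"
    and "e_restricted e lam"
  shows "ceil_part e S (mullineux e q D lam) = conj_part (ceil_part e S lam) \<and>
         floor_part e S (mullineux e q D lam) = conj_part (floor_part e S lam)"
proof -
  define mu where "mu = mullineux e q D lam"
  obtain ks where ks: "f_word e m ks = Some lam" using ex_f_word[OF assms(1,6)] by blast
  \<comment> \<open>Letters relative to the charge: the Mullineux rule changes their sign.\<close>
  define js where "js = map (\<lambda>k. k - m) ks"
  have lam: "f_word e m (map (\<lambda>j. m + j) js) = Some lam"
    using ks by (simp add: js_def comp_def)
  then have mu: "f_word e m (map (\<lambda>j. m - j) js) = Some mu"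
    using assms(4) by (simp add: mullineux_by_crystal_def mu_def)
  obtain xs where xs: "stretches S lam xs" "stretches S mu (map conj_part xs)"
    "\<forall>x \<in> set xs. e_core e x" "sorted_wrt (\<le>) xs"
    using stretches_f_word[OF assms(1,5) lam mu] by blast
  have ne: "rev xs \<noteq> []" using xs(1) by (simp add: stretches_def)
  \<comment> \<open>\<open>xs\<close> is in reading order, so its reversal gives the tensor factors
    from the first, which is the largest, to the last.\<close>
  have "sorted_wrt (\<ge>) (rev xs)" using xs(4) by (simp add: sorted_wrt_rev)
  from ex_runs[OF this ne] obtain cs nus where nus: "length cs = length nus" "\<forall>c \<in> set cs. 0 < c"
    "distinct nus" "set nus = set xs" "rev xs = concat (map2 replicate cs nus)" by auto
  have nus_ne: "nus \<noteq> []" using nus(4) ne by auto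
  have part: "\<forall>nu \<in> set nus. partition nu" using xs(3) nus(4) by (simp add: e_core_def)
  have "length (concat (map2 replicate cs nus)) = sum_list cs"
    using nus(1) by (induction cs nus rule: list_induct2) auto
  then have N: "length xs = sum_list cs" using nus(5) by (metis length_rev)
  have "S (sum_list cs * n) lam = concat (map2 replicate (map ((*) n) cs) nus)" if "n \<ge> 1" for n
    using xs(1) that by (simp add: stretches_def N rev_stretch nus(5) stretch_runs[OF nus(1)])
  then obtain as where fac: "core_factorization e S lam as nus"
    using core_factorization_runs[OF nus(1,2) nus_ne nus(3)] xs(3) nus(4) by metis
  have "S (sum_list cs * n) mu = concat (map2 replicate (map ((*) n) cs) (map conj_part nus))" if "n \<ge> 1" for n
    using xs(2) that nus(1)
    by (simp add: stretches_def N rev_stretch rev_map nus(5) stretch_runs map_runs del: map_concat)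
  \<comment> \<open>Conjugation is injective on partitions, so the run lengths found for
    \<open>lam\<close> also serve for \<open>mu\<close>.\<close>
  moreover have "distinct (map conj_part nus)"
    using nus(3) part conj_part_inject by (auto simp: distinct_map inj_on_def)
  moreover have "\<forall>nu \<in> set (map conj_part nus). e_core e nu"
    using xs(3) nus(4) e_core_conj_part by auto
  ultimately obtain as' where fac': "core_factorization e S mu as' (map conj_part nus)"
    using core_factorization_runs[of cs "map conj_part nus" e S mu] nus(1,2) nus_ne by auto
  show ?thesis
    using ceil_floor_part[OF fac] ceil_floor_part[OF fac'] nus_ne
    by (simp add: mu_def hd_map last_map)
qed

end
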